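(* Consider the D-EX$(\zeta_n)$ model described in the context with $\lim_{n\to\infty}\zeta_n=\zeta\in(0,1)$, and suppose that $F_\infty(t\mid z)$ is strictly decreasing in $z$ for every $t\in(\alpha(1-\zeta),\alpha)$. Let $C_{\zeta,1}=\{t/\alpha-1+\zeta: t\in C_\zeta\}$, $C_{\zeta,2}=\{1-\alpha(1-\zeta)/t: t\in C_\zeta\}$, and let $G_{\zeta,1}$ and $G_{\zeta,2}$ denote the c.d.f.'s of $\lim_{n\to\infty}V_n(Z)/n$ and $\lim_{n\to\infty}V_n(Z)/(R_n(Z)\vee 1)$, respectively. Then \[ G_{\zeta,1}(u)=1-W_Z\big(z(\alpha(u+1-\zeta)\mid\zeta)\big)\quad\text{for } u\in C_{\zeta,1}\cap(0,\zeta), \] \[ G_{\zeta,2}(u)=1-W_Z\Big(z\Big(\tfrac{\alpha(1-\zeta)}{1-u}\,\Big|\,\zeta\Big)\Big)\quad\text{for } u\in C_{\zeta,2}\cap(0,\zeta), \] and \[ \operatorname{EER}_\infty(\zeta)=\int_{C_{\zeta,1}}u\,dG_{\zeta,1}(u),\qquad \operatorname{FDR}_\infty(\zeta)=\int_{C_{\zeta,2}}u\,dG_{\zeta,2}(u). \]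
   Context: Setting (D-EX$(\zeta_n)$ model). Fix $\alpha\in(0,1)$. Let $\mathcal X,\mathcal Z,\mathcal T\subseteq\mathbb R$ be intervals. Let $Z$ be a real random variable with values in $\mathcal Z$, continuous c.d.f. $W_Z$ and distribution $P^Z$, and, for each $n$, let $X_1,\dots,X_n$ be independent real random variables with values in $\mathcal X$, independent of $Z$. Let $g:\mathcal X\times\mathcal Z\to\mathcal T$ be continuous, strictly increasing in its first argument and either strictly monotone or constant in its second argument; let $g_1$ be its inverse in the first argument and, if $g$ is strictly monotone in the second argument, $g_2$ its inverse in the second argument ($g(x,z)=w$ iff $z=g_2(x,w)$). The test statistics are $T_i=g(X_i,Z)$ for $H_i:\vartheta_i=0$ versus $K_i:\vartheta_i>0$. When $H_i$ is true, $X_i$ has continuous c.d.f. $W_X$ and $T_i$ has c.d.f. $W_T$. Given $Z=z$, the $p$-values are $p_i(z)=1-W_T(g(X_i,z))$. Define $F_\infty(t\mid z)=1-W_X\big(g_1(W_T^{-1}(1-t),z)\big)$, $t\in(0,1)$, assumed continuous on $[0,1]$ with $F_\infty(0\mid z)=0$ and right-differentiable at $0$ for all $z$. In the D-EX$(\zeta_n)$ model, for each $n$ exactly $n_0$ of $n$ hypotheses are true, $\zeta_n=n_0/n$, and each false hypothesis has $\vartheta_i=\infty$ and $p$-value $0$ almost surely. LSU procedure at level $\alpha$: with ordered $p$-values $p_{1:n}\le\dots\le p_{n:n}$ and $m=\max\{i:p_{i:n}\le i\alpha/n\}$, reject all $H_i$ with $p_i\le m\alpha/n$. $V_n$ = number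 of rejected true hypotheses, $R_n$ = number of rejections; $V_n(z),R_n(z)$ when $Z=z$ is given. $\operatorname{EER}_\infty(\zeta)=\lim_{n\to\infty}\mathbb E[V_n/n]$ and $\operatorname{FDR}_\infty(\zeta)=\lim_{n\to\infty}\mathbb E[V_n/(R_n\vee 1)]$. Let $F_\infty(t\mid z,\zeta)=(1-\zeta)+\zeta F_\infty(t\mid z)$ and $t(z\mid\zeta)=\sup\{t\in[\alpha(1-\zeta),\alpha]:F_\infty(t\mid z,\zeta)=t/\alpha\}$. $t(z\mid\zeta)$ is a largest crossing point (LCP) if for some $\epsilon>0$, $F_\infty(t\mid z,\zeta)>t/\alpha$ on $[t(z\mid\zeta)-\epsilon,t(z\mid\zeta))$ and $F_\infty(t\mid z,\zeta)<t/\alpha$ on $(t(z\mid\zeta),t(z\mid\zeta)+\epsilon]$. $C_\zeta$ is the set of LCPs, $D_\zeta=\{z:t(z\mid\zeta)\in C_\zeta\}$, and it is assumed that $P^Z(D_\zeta)=1$. For $t\in(\alpha(1-\zeta),\alpha)$, $z(t\mid\zeta)$ denotes the value of $z$ with $F_\infty(t\mid z,\zeta)=t/\alpha$, namely $z(t\mid\zeta)=g_2\big(W_X^{-1}((1-t/\alpha)/\zeta),\,W_T^{-1}(1-t)\big)$. *)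

theory Defs
  imports "HOL-Probability.Probability"
begin

definition ord_stat :: "(nat \<Rightarrow> real) \<Rightarrow> nat \<Rightarrow> nat \<Rightarrow> real" where
  "ord_stat p n k = sort (map p [0..<n]) ! (k - 1)"

definition lsu_m :: "real \<Rightarrow> nat \<Rightarrow> (nat \<Rightarrow> real) \<Rightarrow> nat" where
  "lsu_m \<alpha> n p = Max (insert 0 {k \<in> {1..n}. ord_stat p n k \<le> real k * \<alpha> / real n})"

definition lsu_rej :: "real \<Rightarrow> nat \<Rightarrow> (nat \<Rightarrow> real) \<Rightarrow> nat set" where
  "lsu_rej \<alpha> n p = (if lsu_m \<alpha> n p = 0 then {}
      else {i \<in> {..<n}. p i \<le> real (lsu_m \<alpha> n p) * \<alpha> / real n})"

text \<open>V_n: number of rejected true hypotheses (I0 = index set of true hypotheses).\<close>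
definition lsu_V :: "real \<Rightarrow> nat \<Rightarrow> nat set \<Rightarrow> (nat \<Rightarrow> real) \<Rightarrow> nat" where
  "lsu_V \<alpha> n I0 p = card (lsu_rej \<alpha> n p \<inter> I0)"

definition lsu_R :: "real \<Rightarrow> nat \<Rightarrow> (nat \<Rightarrow> real) \<Rightarrow> nat" where
  "lsu_R \<alpha> n p = card (lsu_rej \<alpha> n p)"

definition gen_inv :: "(real \<Rightarrow> real) \<Rightarrow> real \<Rightarrow> real" where
  "gen_inv W u = Inf {x. u \<le> W x}"

definition Fmix :: "real \<Rightarrow> (real \<Rightarrow> real \<Rightarrow> real) \<Rightarrow> real \<Rightarrow> real \<Rightarrow> real" where
  "Fmix \<zeta> F t z = (1 - \<zeta>) + \<zeta> * F t z"

definition tcross :: "real \<Rightarrow> real \<Rightarrow> (real \<Rightarrow> real \<Rightarrow> real) \<Rightarrow> real \<Rightarrow> real" where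
  "tcross \<alpha> \<zeta> F z = Sup {t \<in> {\<alpha> * (1 - \<zeta>)..\<alpha>}. Fmix \<zeta> F t z = t / \<alpha>}"

definition is_LCP :: "real \<Rightarrow> real \<Rightarrow> (real \<Rightarrow> real \<Rightarrow> real) \<Rightarrow> real \<Rightarrow> real \<Rightarrow> bool" where
  "is_LCP \<alpha> \<zeta> F z t \<longleftrightarrow> (\<exists>\<epsilon>>0.
      (\<forall>s\<in>{t - \<epsilon>..<t}. Fmix \<zeta> F s z > s / \<alpha>) \<and>
      (\<forall>s\<in>{t<..t + \<epsilon>}. Fmix \<zeta> F s z < s / \<alpha>))"

definition LCP_set :: "real \<Rightarrow> real \<Rightarrow> (real \<Rightarrow> real \<Rightarrow> real) \<Rightarrow> real set \<Rightarrow> real set" where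
  "LCP_set \<alpha> \<zeta> F Zs = {tcross \<alpha> \<zeta> F z | z. z \<in> Zs \<and> is_LCP \<alpha> \<zeta> F z (tcross \<alpha> \<zeta> F z)}"

definition D_set :: "real \<Rightarrow> real \<Rightarrow> (real \<Rightarrow> real \<Rightarrow> real) \<Rightarrow> real set \<Rightarrow> real set" where
  "D_set \<alpha> \<zeta> F Zs = {z \<in> Zs. tcross \<alpha> \<zeta> F z \<in> LCP_set \<alpha> \<zeta> F Zs}"

definition zcross :: "real \<Rightarrow> real \<Rightarrow> (real \<Rightarrow> real) \<Rightarrow> (real \<Rightarrow> real)
    \<Rightarrow> (real \<Rightarrow> real \<Rightarrow> real) \<Rightarrow> real \<Rightarrow> real" where
  "zcross \<alpha> \<zeta> WX WT g2 t = g2 (gen_inv WX ((1 - t / \<alpha>) / \<zeta>)) (gen_inv WT (1 - t))"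

end

theory Submission
  imports Defs "HOL-Probability.Probability"
begin

text \<open>
  A true p-value is at most s iff the corresponding observation is at least a cut-off that depends
  only on s and Z. By Hoeffding and Borel-Cantelli the empirical distribution functions of the
  observations almost surely converge at all points simultaneously, hence also at these random
  cut-offs, and no conditioning on Z is needed. So the proportion of p-values below s converges to
  \<open>Fmix \<zeta> F s (Z \<omega>)\<close>, and the LSU threshold converges to the largest crossing point
  \<open>tcross \<alpha> \<zeta> F (Z \<omega>)\<close>. The crossing point is antitone in z and strictly so where it
  lies in the open interval; this turns the distribution function of the limits into a tail
  probability of Z and shows that the set of LCPs is Borel. The expectations converge by dominated
  convergence.
\<close>

section \<open>Largest crossing points\<close>

text \<open>The integrals over the sets of limit values require the set of LCPs to be measurable,
  yet it is an image of a set of z under \<open>tcross\<close>, and images of Borel sets need not be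
  Borel. Monotonicity in z settles this except at the two ends of [\<alpha>(1-\<zeta>), \<alpha>],
  where different z may share a crossing point. The same ends disturb the convergence: z in D only
  says that some z' has an LCP at the crossing point of z. In the interior injectivity gives z' = z.
  At the lower end the zero p-values of the false hypotheses supply the missing inequality; at the
  upper end everything is rejected.

  A second obstacle is that \<open>g1 w z\<close> is determined only where g x z = w has a solution
  x. Where it has none, F must still be shown to be the true conditional distribution function. That
  argument needs z to lie strictly between two points of its interval, which holds almost surely
  because Z has no atoms.\<close>

lemma strict_antitone_image_borel_bounded:
  fixes f :: "real \<Rightarrow> real"
  assumes E: "E \<in> sets borel" and f: "monotone_on E (<) (>) f"
    and bdE: "E \<subseteq> {-c..c}" and bdf: "f ` E \<subseteq> {l..u}"
  shows "f ` E \<in> sets borel"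
proof -
  \<comment> \<open>\<open>h\<close> is a generalized inverse of \<open>f\<close> and
    \<open>k\<close> an extension of \<open>f\<close> to the whole line. Both are antitone, hence
    Borel, whatever \<open>f\<close> is. The image is then cut out by measurable conditions:
    \<open>h t\<close> must lie in \<open>E\<close>, and \<open>k\<close> must lead back to
    \<open>t\<close>. The elements \<open>- c\<close> and \<open>l\<close> only keep the suprema
    over nonempty sets; they lie below all competitors.\<close>
  define h where "h t = Sup (insert (- c) {z \<in> E. t \<le> f z})" for t
  define k where "k y = Sup (insert l {f z | z. z \<in> E \<and> y \<le> z})" for y
  have "mono (\<lambda>t. - h t)"
    unfolding mono_def h_def using bdE
    by (auto intro!: cSup_subset_mono bdd_aboveI[of _ "max c (- c)"] simp: subset_iff)
  then have "(\<lambda>t. - (- h t)) \<in> borel_measurable borel"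
    by (intro borel_measurable_uminus borel_measurable_mono)
  then have [measurable]: "h \<in> borel_measurable borel" by simp
  have "mono (\<lambda>t. - k t)"
    unfolding mono_def k_def using bdf
    by (auto intro!: cSup_subset_mono bdd_aboveI[of _ "max l u"] simp: subset_iff image_iff)
  then have "(\<lambda>t. - (- k t)) \<in> borel_measurable borel"
    by (intro borel_measurable_uminus borel_measurable_mono)
  then have [measurable]: "k \<in> borel_measurable borel" by simp
  have le_iff: "f z \<le> f z' \<longleftrightarrow> z' \<le> z" if "z \<in> E" "z' \<in> E" for z z'
    using monotone_onD[OF f that] monotone_onD[OF f that(2,1)] by (metis less_le_not_le linorder_le_cases order.order_iff_strict)
  have hf: "h (f z) = z" if "z \<in> E" for z
    unfolding h_def by (rule cSup_eq_maximum) (use that bdE le_iff in auto)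
  have kf: "k z = f z" if "z \<in> E" for z
    unfolding k_def by (rule cSup_eq_maximum) (use that bdf le_iff in auto)
  have "f ` E = {t. h t \<in> E \<and> k (h t) = t}"
    using hf kf by (auto simp: image_iff) metis
  also have "\<dots> \<in> sets borel"
    using E by measurable
  finally show ?thesis .
qed

lemma strict_antitone_image_borel:
  fixes f :: "real \<Rightarrow> real"
  assumes E: "E \<in> sets borel" and f: "monotone_on E (<) (>) f" and bdf: "f ` E \<subseteq> {l..u}"
  shows "f ` E \<in> sets borel"
proof -
  have "f ` (E \<inter> {- real n..real n}) \<in> sets borel" for n
    by (rule strict_antitone_image_borel_bounded[where c = "real n"])
       (use E bdf in \<open>auto intro: monotone_on_subset[OF f]\<close>)
  moreover have "f ` E = (\<Union>n. f ` (E \<inter> {- real n..real n}))"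
  proof -
    have "\<exists>n. z \<in> {- real n..real n}" for z :: real
      using real_arch_simple[of "\<bar>z\<bar>"] by (auto simp: abs_le_iff) (smt (verit))
    then show ?thesis by blast
  qed
  ultimately show ?thesis by auto
qed

text \<open>No measurability of \<open>Q\<close> is needed: a down-set of an interval is again an
  interval.\<close>

lemma down_set_borel:
  fixes I :: "real set"
  assumes "is_interval I" "\<And>x y. x \<in> I \<Longrightarrow> y \<in> I \<Longrightarrow> x \<le> y \<Longrightarrow> Q y \<Longrightarrow> Q x"
  shows "{x \<in> I. Q x} \<in> sets borel"
proof (rule real_interval_borel_measurable)
  show "is_interval {x \<in> I. Q x}"
    using assms unfolding is_interval_1 by (smt (verit, best) mem_Collect_eq)
qed

section \<open>Dependence of the crossing point on z\<close>

locale crossing =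
  fixes \<alpha> \<zeta> :: real and F :: "real \<Rightarrow> real \<Rightarrow> real" and Zs :: "real set"
  assumes alpha: "0 < \<alpha>" "\<alpha> < 1"
    and zeta: "0 < \<zeta>" "\<zeta> < 1"
    and Zs_interval: "is_interval Zs"
    and F_bounds: "\<And>z t. z \<in> Zs \<Longrightarrow> 0 < t \<Longrightarrow> t < 1 \<Longrightarrow> 0 \<le> F t z \<and> F t z \<le> 1"
    and F_cont: "\<And>z. z \<in> Zs \<Longrightarrow> continuous_on {0..1} (\<lambda>t. F t z)"
    and F_decr: "\<And>t. \<alpha> * (1 - \<zeta>) < t \<Longrightarrow> t < \<alpha> \<Longrightarrow> monotone_on Zs (<) (>) (\<lambda>z. F t z)"
begin

definition lo :: real where "lo = \<alpha> * (1 - \<zeta>)"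

definition excess :: "real \<Rightarrow> real \<Rightarrow> real" where "excess t z = Fmix \<zeta> F t z - t / \<alpha>"

abbreviation \<tau> :: "real \<Rightarrow> real" where "\<tau> z \<equiv> tcross \<alpha> \<zeta> F z"

lemma lo_pos: "0 < lo" and lo_less: "lo < \<alpha>"
  using alpha zeta by (auto simp: lo_def)

lemma excess_cont: "z \<in> Zs \<Longrightarrow> continuous_on {lo..\<alpha>} (\<lambda>t. excess t z)"
  unfolding excess_def Fmix_def using lo_pos alpha
  by (intro continuous_intros continuous_on_subset[OF F_cont]) auto

text \<open>At \<open>lo\<close> the excess equals \<zeta> F, and at \<alpha> it equals \<zeta> (F -
  1). These opposite signs make the set in the definition of \<open>tcross\<close> nonempty.\<close>

lemma excess_lo: "z \<in> Zs \<Longrightarrow> 0 \<le> excess lo z"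
  using F_bounds[of z lo] lo_pos lo_less alpha zeta by (simp add: excess_def Fmix_def) (simp add: lo_def)

lemma excess_alpha: "z \<in> Zs \<Longrightarrow> excess \<alpha> z \<le> 0"
  using F_bounds[of z \<alpha>] alpha zeta mult_left_le[of "F \<alpha> z" \<zeta>] by (simp add: excess_def Fmix_def)

lemma excess_zero:
  assumes "z \<in> Zs" "lo \<le> s" "s \<le> \<alpha>" "0 \<le> excess s z"
  obtains t where "s \<le> t" "t \<le> \<alpha>" "excess t z = 0"
proof -
  have "\<exists>t. s \<le> t \<and> t \<le> \<alpha> \<and> excess t z = 0"
    by (rule IVT2') (use assms excess_alpha in \<open>auto intro: continuous_on_subset[OF excess_cont]\<close>)
  then show ?thesis using that by blast
qed

lemma tcross_eq: "\<tau> z = Sup {t \<in> {lo..\<alpha>}. excess t z = 0}"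
  by (simp add: tcross_def excess_def lo_def)

lemma
  assumes z: "z \<in> Zs"
  shows tcross_ge_lo: "lo \<le> \<tau> z" and tcross_le_alpha: "\<tau> z \<le> \<alpha>" and excess_tcross: "excess (\<tau> z) z = 0"
proof -
  let ?S = "{t \<in> {lo..\<alpha>}. excess t z = 0}"
  have "closed ?S"
    using continuous_closed_preimage_constant[OF excess_cont[OF z]] by simp
  moreover have "?S \<noteq> {}"
    using excess_zero[OF z _ _ excess_lo[OF z]] lo_less by force
  moreover have "bdd_above ?S" by (auto intro: bdd_aboveI[of _ \<alpha>])
  ultimately have "\<tau> z \<in> ?S"
    unfolding tcross_eq by (intro closed_contains_Sup)
  then show "lo \<le> \<tau> z" "\<tau> z \<le> \<alpha>" "excess (\<tau> z) z = 0" by auto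
qed

text \<open>The point s need not be a crossing itself: the intermediate value theorem finds one
  between s and \<alpha>.\<close>

lemma tcross_upper:
  assumes "z \<in> Zs" "lo \<le> s" "s \<le> \<alpha>" "0 \<le> excess s z"
  shows "s \<le> \<tau> z"
proof -
  obtain t where t: "s \<le> t" "t \<le> \<alpha>" "excess t z = 0" using excess_zero[OF assms] .
  have "t \<le> \<tau> z"
    unfolding tcross_eq by (rule cSup_upper) (use t assms in \<open>auto intro: bdd_aboveI[of _ \<alpha>]\<close>)
  with t show ?thesis by simp
qed

lemma excess_neg: "z \<in> Zs \<Longrightarrow> \<tau> z < s \<Longrightarrow> s \<le> \<alpha> \<Longrightarrow> excess s z < 0"
  using tcross_upper[of z s] tcross_ge_lo[of z] by force

lemma excess_decr:
  assumes "z \<in> Zs" "z' \<in> Zs" "z < z'" "lo < s" "s < \<alpha>"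
  shows "excess s z' < excess s z"
  using monotone_onD[OF F_decr assms(1-3), of s] assms zeta by (simp add: excess_def Fmix_def lo_def)

text \<open>Strict decrease is assumed on the open interval only. A left limit carries the weak
  inequality to s = \<alpha>, which \<open>tcross_antimono\<close> uses because a crossing point may
  equal \<alpha>.\<close>

lemma excess_decr_weak:
  assumes "z \<in> Zs" "z' \<in> Zs" "z < z'" "lo < s" "s \<le> \<alpha>"
  shows "excess s z' \<le> excess s z"
proof (cases "s = \<alpha>")
  case True
  have lim: "((\<lambda>t. excess t y) \<longlongrightarrow> excess \<alpha> y) (at_left \<alpha>)" if "y \<in> Zs" for y
    using excess_cont[OF that] lo_less
    by (metis atLeastAtMost_iff at_within_Icc_at_left continuous_on_def less_imp_le order_refl)
  have "\<forall>\<^sub>F t in at_left \<alpha>. t \<in> {lo<..<\<alpha>}"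
    using lo_less by (auto intro: eventually_at_leftI)
  then have "\<forall>\<^sub>F t in at_left \<alpha>. excess t z' \<le> excess t z"
    by eventually_elim (use excess_decr[OF assms(1-3)] in \<open>auto intro: less_imp_le\<close>)
  then show ?thesis
    unfolding True using tendsto_le[OF trivial_limit_at_left_real lim lim] assms(1,2) by blast
next
  case False
  then show ?thesis using excess_decr[of z z' s] assms by simp
qed

lemma tcross_antimono:
  assumes "z \<in> Zs" "z' \<in> Zs" "z \<le> z'"
  shows "\<tau> z' \<le> \<tau> z"
proof (rule ccontr)
  assume *: "\<not> \<tau> z' \<le> \<tau> z"
  then have "z < z'" using assms by (cases "z = z'") auto
  moreover have "lo < \<tau> z'" using * tcross_ge_lo[of z] assms by simp
  ultimately have "excess (\<tau> z') z' \<le> excess (\<tau> z') z"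
    using assms tcross_le_alpha by (intro excess_decr_weak) auto
  with excess_neg[of z "\<tau> z'"] * excess_tcross[of z'] assms tcross_le_alpha[of z'] show False by simp
qed

text \<open>Two different parameters would both have excess 0 at the common level, against strict
  decrease in z.\<close>

lemma tcross_inj:
  assumes "z \<in> Zs" "z' \<in> Zs" "lo < \<tau> z" "\<tau> z < \<alpha>" "\<tau> z' = \<tau> z"
  shows "z' = z"
proof (rule ccontr)
  assume "z' \<noteq> z"
  moreover have "excess (\<tau> z) z = 0" "excess (\<tau> z) z' = 0"
    using excess_tcross[OF assms(1)] excess_tcross[OF assms(2)] assms(5) by auto
  ultimately show False
    using excess_decr[OF assms(1,2) _ assms(3,4)] excess_decr[OF assms(2,1) _ assms(3,4)]
    by (metis less_irrefl linorder_neqE)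
qed

lemma tcross_le_iff:
  assumes "z \<in> Zs" "z0 \<in> Zs" "lo < \<tau> z0" "\<tau> z0 < \<alpha>"
  shows "\<tau> z \<le> \<tau> z0 \<longleftrightarrow> z0 \<le> z"
  using tcross_antimono[of z z0] tcross_antimono[of z0 z] tcross_inj[of z0 z] assms
  by (metis linorder_le_cases order_antisym)

section \<open>Measurability of the set of LCPs\<close>

text \<open>By \<open>excess_neg\<close> the right half of the LCP condition is automatic below
  \<alpha>, so only the left half remains. A rational witness r prepares a countable union.\<close>

lemma is_LCP_iff:
  assumes z: "z \<in> Zs" "lo < \<tau> z" "\<tau> z < \<alpha>"
  shows "is_LCP \<alpha> \<zeta> F z (\<tau> z) \<longleftrightarrow> (\<exists>r\<in>\<rat>. lo < r \<and> r < \<tau> z \<and> (\<forall>s\<in>{r..<\<tau> z}. 0 < excess s z))"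
proof
  assume "is_LCP \<alpha> \<zeta> F z (\<tau> z)"
  then obtain e where e: "e > 0" "\<forall>s\<in>{\<tau> z - e..<\<tau> z}. s / \<alpha> < Fmix \<zeta> F s z"
    unfolding is_LCP_def by blast
  obtain r where "r \<in> \<rat>" "max lo (\<tau> z - e) < r" "r < \<tau> z"
    using Rats_dense_in_real[of "max lo (\<tau> z - e)" "\<tau> z"] e z by auto
  with e show "\<exists>r\<in>\<rat>. lo < r \<and> r < \<tau> z \<and> (\<forall>s\<in>{r..<\<tau> z}. 0 < excess s z)"
    by (intro bexI[of _ r]) (auto simp: excess_def)
next
  assume "\<exists>r\<in>\<rat>. lo < r \<and> r < \<tau> z \<and> (\<forall>s\<in>{r..<\<tau> z}. 0 < excess s z)"
  then obtain r where r: "r < \<tau> z" "\<And>s. s\<in>{r..<\<tau> z} \<Longrightarrow> 0 < excess s z" by auto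
  \<comment> \<open>The width min(\<tau> z - r, \<alpha> - \<tau> z) serves as \<epsilon>: the left
    window stays to the right of r, and the right window does not pass \<alpha>, beyond which
    nothing is known about the excess.\<close>
  have "s / \<alpha> < Fmix \<zeta> F s z" if "s \<in> {\<tau> z - min (\<tau> z - r) (\<alpha> - \<tau> z)..<\<tau> z}" for s
  proof -
    have "r \<le> s" "s < \<tau> z" using that by (auto simp: min_def split: if_splits)
    then show ?thesis using r(2)[of s] by (simp add: excess_def)
  qed
  moreover have "Fmix \<zeta> F s z < s / \<alpha>" if "s \<in> {\<tau> z<..\<tau> z + min (\<tau> z - r) (\<alpha> - \<tau> z)}" for s
  proof -
    have "\<tau> z < s" "s \<le> \<alpha>" using that by (auto simp: min_def split: if_splits)
    then show ?thesis using excess_neg[OF z(1), of s] by (simp add: excess_def)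
  qed
  ultimately show "is_LCP \<alpha> \<zeta> F z (\<tau> z)"
    unfolding is_LCP_def using r z by (intro exI[of _ "min (\<tau> z - r) (\<alpha> - \<tau> z)"]) auto
qed

lemma tcross_gt_borel: "{z \<in> Zs. r < \<tau> z} \<in> sets borel"
  by (rule down_set_borel[OF Zs_interval]) (meson tcross_antimono less_le_trans)

lemma tcross_le_borel: "{z \<in> Zs. \<tau> z \<le> r} \<in> sets borel"
proof -
  have "{z \<in> Zs. \<tau> z \<le> r} = Zs - {z \<in> Zs. r < \<tau> z}" by auto
  then show ?thesis
    using tcross_gt_borel real_interval_borel_measurable[OF Zs_interval] by auto
qed

lemma tcross_lt_borel: "{z \<in> Zs. \<tau> z < r} \<in> sets borel"
proof -
  have "{z \<in> Zs. \<tau> z < r} = (\<Union>q\<in>\<rat> \<inter> {..<r}. {z \<in> Zs. \<tau> z \<le> q})"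
  proof (intro set_eqI iffI)
    fix z assume "z \<in> {z \<in> Zs. \<tau> z < r}"
    then obtain q where "q \<in> \<rat>" "\<tau> z < q" "q < r" "z \<in> Zs"
      using Rats_dense_in_real[of "\<tau> z" r] by auto
    then show "z \<in> (\<Union>q\<in>\<rat> \<inter> {..<r}. {z \<in> Zs. \<tau> z \<le> q})"
      by (intro UN_I[of q]) auto
  qed auto
  then show ?thesis
    using tcross_le_borel countable_rat by (auto intro!: sets.countable_UN')
qed

definition LCP_interior :: "real set" where
  "LCP_interior = {z \<in> Zs. lo < \<tau> z \<and> \<tau> z < \<alpha> \<and> is_LCP \<alpha> \<zeta> F z (\<tau> z)}"

text \<open>The LCP condition is a countable combination of conditions on z that hold on down-sets of
  the interval \<^term>\<open>Zs\<close>, i.e. on intervals.\<close>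

lemma LCP_interior_borel: "LCP_interior \<in> sets borel"
proof -
  define pos where "pos r q = {z \<in> Zs. \<forall>s\<in>{r..q}. 0 < excess s z}" for r q
  have pos: "pos r q \<in> sets borel" if "lo < r" "q < \<alpha>" for r q
    unfolding pos_def
  proof (rule down_set_borel[OF Zs_interval])
    fix x y assume "x \<in> Zs" "y \<in> Zs" "x \<le> y" and pos: "\<forall>s\<in>{r..q}. 0 < excess s y"
    then show "\<forall>s\<in>{r..q}. 0 < excess s x"
      using excess_decr[of x y] that by (cases "x = y") (auto intro: less_trans)
  qed
  \<comment> \<open>The range of s depends on z through \<tau> z. To get conditions with fixed
    ranges, each rational q is handled by an alternative: either q is already past the crossing
    point, or positivity holds on all of [r, q].\<close>
  have left: "(\<forall>s\<in>{r..<\<tau> z}. 0 < excess s z) \<longleftrightarrow>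
      (\<forall>q\<in>\<rat> \<inter> {r<..<\<alpha>}. z \<in> {z \<in> Zs. \<tau> z \<le> q} \<union> pos r q)"
    if "z \<in> Zs" "\<tau> z < \<alpha>" "r < \<tau> z" for z r
  proof
    assume "\<forall>s\<in>{r..<\<tau> z}. 0 < excess s z"
    then show "\<forall>q\<in>\<rat> \<inter> {r<..<\<alpha>}. z \<in> {z \<in> Zs. \<tau> z \<le> q} \<union> pos r q"
      using that by (auto simp: pos_def)
  next
    assume *: "\<forall>q\<in>\<rat> \<inter> {r<..<\<alpha>}. z \<in> {z \<in> Zs. \<tau> z \<le> q} \<union> pos r q"
    show "\<forall>s\<in>{r..<\<tau> z}. 0 < excess s z"
    proof
      fix s assume s: "s \<in> {r..<\<tau> z}"
      then obtain q where "q \<in> \<rat>" "s < q" "q < \<tau> z"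
        using Rats_dense_in_real[of s "\<tau> z"] by auto
      with s that have "q \<in> \<rat> \<inter> {r<..<\<alpha>}" by auto
      with * have "z \<in> {z \<in> Zs. \<tau> z \<le> q} \<union> pos r q" by blast
      with \<open>q < \<tau> z\<close> \<open>s < q\<close> s show "0 < excess s z" by (simp add: pos_def)
    qed
  qed
  have "LCP_interior = {z \<in> Zs. lo < \<tau> z} \<inter> {z \<in> Zs. \<tau> z < \<alpha>} \<inter>
      (\<Union>r\<in>\<rat> \<inter> {lo<..}. {z \<in> Zs. r < \<tau> z} \<inter> (Zs \<inter> (\<Inter>q\<in>\<rat> \<inter> {r<..<\<alpha>}. {z \<in> Zs. \<tau> z \<le> q} \<union> pos r q)))"
    (is "_ = ?R")
  proof (intro set_eqI)
    fix z
    show "z \<in> LCP_interior \<longleftrightarrow> z \<in> ?R"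
    proof (cases "z \<in> Zs \<and> lo < \<tau> z \<and> \<tau> z < \<alpha>")
      case True
      then have z: "z \<in> Zs" "lo < \<tau> z" "\<tau> z < \<alpha>" by auto
      have "z \<in> LCP_interior \<longleftrightarrow> (\<exists>r\<in>\<rat>. lo < r \<and> r < \<tau> z \<and> (\<forall>s\<in>{r..<\<tau> z}. 0 < excess s z))"
        using is_LCP_iff[OF z] z by (simp add: LCP_interior_def)
      also have "\<dots> \<longleftrightarrow> (\<exists>r\<in>\<rat>. lo < r \<and> r < \<tau> z \<and> (\<forall>q\<in>\<rat> \<inter> {r<..<\<alpha>}. z \<in> {z \<in> Zs. \<tau> z \<le> q} \<union> pos r q))"
        using left[OF z(1,3)] by blast
      also have "\<dots> \<longleftrightarrow> z \<in> ?R" using z by auto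
      finally show ?thesis .
    qed (auto simp: LCP_interior_def)
  qed
  also have "\<dots> \<in> sets borel"
    using tcross_gt_borel tcross_lt_borel tcross_le_borel pos real_interval_borel_measurable[OF Zs_interval] countable_rat
    by (intro sets.Int sets.countable_UN'' sets.countable_INT'' sets.Un) auto
  finally show ?thesis .
qed

text \<open>On \<open>LCP_interior\<close> the crossing point is strictly antitone, so the image is
  Borel; the levels \<open>lo\<close> and \<alpha>, where injectivity may fail, contribute at most
  two further points.\<close>

lemma LCP_set_borel: "LCP_set \<alpha> \<zeta> F Zs \<in> sets borel"
proof -
  have "\<tau> ` LCP_interior \<in> sets borel"
  proof (rule strict_antitone_image_borel[OF LCP_interior_borel])
    show "monotone_on LCP_interior (<) (>) \<tau>"
    proof (rule monotone_onI)
      fix x y assume "x \<in> LCP_interior" "y \<in> LCP_interior" "x < y"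
      then show "\<tau> y < \<tau> x"
        using tcross_le_iff[of x y] by (force simp: LCP_interior_def)
    qed
    show "\<tau> ` LCP_interior \<subseteq> {lo..\<alpha>}" by (auto simp: LCP_interior_def)
  qed
  moreover have "LCP_set \<alpha> \<zeta> F Zs = \<tau> ` LCP_interior \<union> (LCP_set \<alpha> \<zeta> F Zs \<inter> {lo, \<alpha>})"
    using tcross_ge_lo tcross_le_alpha
    by (fastforce simp: LCP_set_def LCP_interior_def order.order_iff_strict)
  moreover have "LCP_set \<alpha> \<zeta> F Zs \<inter> {lo, \<alpha>} \<in> sets borel"
    by (rule sets.countable) (auto intro: countable_finite finite_subset[of _ "{lo, \<alpha>}"])
  ultimately show ?thesis by (metis sets.Un)
qed

end

section \<open>The linear step-up procedure\<close>

lemma sorted_nth_le_iff: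
  "sorted xs \<Longrightarrow> k < length xs \<Longrightarrow> xs ! k \<le> c \<longleftrightarrow> k < length (filter (\<lambda>x. x \<le> c) xs)"
proof (induction xs arbitrary: k)
  case (Cons x xs)
  show ?case
  proof (cases "x \<le> c")
    case True
    then show ?thesis using Cons by (cases k) auto
  next
    case False
    then have "filter (\<lambda>x. x \<le> c) (x # xs) = []"
      using Cons.prems by (auto simp: filter_empty_conv)
    moreover have "\<not> (x # xs) ! k \<le> c"
      using False Cons.prems by (cases k) (auto, meson nth_mem order_trans)
    ultimately show ?thesis by simp
  qed
qed simp

definition count_le :: "nat \<Rightarrow> (nat \<Rightarrow> real) \<Rightarrow> real \<Rightarrow> nat" where
  "count_le n p c = card {i \<in> {..<n}. p i \<le> c}"

lemma count_le_mono: "c \<le> d \<Longrightarrow> count_le n p c \<le> count_le n p d"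
  unfolding count_le_def by (intro card_mono) auto

lemma count_le_upper: "count_le n p c \<le> n"
  unfolding count_le_def using card_mono[of "{..<n}" "{i \<in> {..<n}. p i \<le> c}"] by auto

lemma count_le_eq:
  assumes "I \<subseteq> {..<n}" "\<And>i. i < n \<Longrightarrow> i \<notin> I \<Longrightarrow> p i = 0" "0 \<le> s"
  shows "count_le n p s = card {i \<in> I. p i \<le> s} + (n - card I)"
proof -
  have "{i \<in> {..<n}. p i \<le> s} = {i \<in> I. p i \<le> s} \<union> ({..<n} - I)" using assms by force
  moreover have "card ({i \<in> I. p i \<le> s} \<union> ({..<n} - I)) = card {i \<in> I. p i \<le> s} + card ({..<n} - I)"
    using finite_subset[OF assms(1)] by (intro card_Un_disjoint) auto
  moreover have "card ({..<n} - I) = n - card I"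
    using assms(1) by (simp add: card_Diff_subset finite_subset)
  ultimately show ?thesis by (simp add: count_le_def)
qed

text \<open>Removes the sorting: from here on the procedure depends on the p-values only through
  \<open>count_le\<close>, which is n times their empirical distribution function.\<close>

lemma ord_stat_le_iff:
  assumes "1 \<le> k" "k \<le> n"
  shows "ord_stat p n k \<le> c \<longleftrightarrow> k \<le> count_le n p c"
proof -
  have "ord_stat p n k \<le> c \<longleftrightarrow> k - 1 < length (filter (\<lambda>x. x \<le> c) (sort (map p [0..<n])))"
    unfolding ord_stat_def by (rule sorted_nth_le_iff) (use assms in auto)
  also have "length (filter (\<lambda>x. x \<le> c) (sort (map p [0..<n]))) = length (filter (\<lambda>x. x \<le> c) (map p [0..<n]))"
    by (metis mset_filter mset_sort size_mset)
  also have "\<dots> = count_le n p c"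
    by (simp add: filter_map comp_def count_le_def distinct_card[symmetric] atLeast0LessThan Collect_conj_eq[symmetric])
  finally show ?thesis using assms by auto
qed

lemma lsu_m_eq: "lsu_m \<alpha> n p = Max (insert 0 {k \<in> {1..n}. k \<le> count_le n p (real k * \<alpha> / real n)})"
  unfolding lsu_m_def by (rule arg_cong[of _ _ "\<lambda>A. Max (insert 0 A)"]) (auto simp: ord_stat_le_iff)

lemma lsu_m_upper:
  "1 \<le> k \<Longrightarrow> k \<le> n \<Longrightarrow> k \<le> count_le n p (real k * \<alpha> / real n) \<Longrightarrow> k \<le> lsu_m \<alpha> n p"
  unfolding lsu_m_eq by (rule Max_ge) auto

lemma lsu_m_le: "lsu_m \<alpha> n p \<le> n"
  unfolding lsu_m_eq by (subst Max_le_iff) auto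

lemma lsu_m_le_count: "lsu_m \<alpha> n p \<le> count_le n p (real (lsu_m \<alpha> n p) * \<alpha> / real n)"
proof -
  have "lsu_m \<alpha> n p \<in> insert 0 {k \<in> {1..n}. k \<le> count_le n p (real k * \<alpha> / real n)}"
    unfolding lsu_m_eq by (rule Max_in) auto
  then show ?thesis by auto
qed

text \<open>If k > m p-values lay below the threshold belonging to m, they would lie below the
  larger threshold of k as well. Then k would satisfy the step-up condition, against the maximality
  of m.\<close>

lemma count_le_lsu_m:
  assumes "lsu_m \<alpha> n p \<noteq> 0" "0 \<le> \<alpha>"
  shows "count_le n p (real (lsu_m \<alpha> n p) * \<alpha> / real n) = lsu_m \<alpha> n p"
proof -
  let ?m = "lsu_m \<alpha> n p"
  let ?k = "count_le n p (real ?m * \<alpha> / real n)"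
  have "real ?m * \<alpha> / real n \<le> real ?k * \<alpha> / real n"
    using lsu_m_le_count[of \<alpha> n p] assms by (intro divide_right_mono mult_right_mono) auto
  then have "?k \<le> count_le n p (real ?k * \<alpha> / real n)"
    by (rule count_le_mono)
  then have "?k \<le> ?m"
    using lsu_m_upper[of ?k n p \<alpha>] count_le_upper[of n p] assms lsu_m_le_count[of \<alpha> n p] by auto
  then show ?thesis using lsu_m_le_count[of \<alpha> n p] by simp
qed

lemma lsu_R_eq: "0 \<le> \<alpha> \<Longrightarrow> lsu_R \<alpha> n p = lsu_m \<alpha> n p"
  using count_le_lsu_m[of \<alpha> n p] by (auto simp: lsu_R_def lsu_rej_def count_le_def)

lemma lsu_V_le_R: "lsu_V \<alpha> n I p \<le> lsu_R \<alpha> n p"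
  unfolding lsu_V_def lsu_R_def by (intro card_mono) (auto simp: lsu_rej_def)

lemma lsu_R_le: "lsu_R \<alpha> n p \<le> n"
proof -
  have "lsu_rej \<alpha> n p \<subseteq> {..<n}" by (auto simp: lsu_rej_def)
  from card_mono[OF _ this] show ?thesis by (simp add: lsu_R_def)
qed

text \<open>With k p-values at or below s, the premise reads s \<le> k \<alpha> / n. Hence k
  satisfies the step-up condition and m is at least k.\<close>

lemma lsu_threshold_lower:
  assumes "0 < \<alpha>" "0 < n" "0 < s" "s / \<alpha> \<le> real (count_le n p s) / real n"
  shows "s \<le> real (lsu_m \<alpha> n p) * \<alpha> / real n"
proof -
  let ?k = "count_le n p s"
  have s: "s \<le> real ?k * \<alpha> / real n" using assms by (simp add: field_simps)
  then have "?k \<noteq> 0" using assms by (intro notI) simp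
  then have "?k \<le> lsu_m \<alpha> n p"
    using count_le_mono[OF s] count_le_upper by (intro lsu_m_upper) auto
  then have "real ?k * \<alpha> / real n \<le> real (lsu_m \<alpha> n p) * \<alpha> / real n"
    using assms by (intro divide_right_mono mult_right_mono) auto
  with s show ?thesis by simp
qed

text \<open>A p-value 0 lies below every threshold, so all hypotheses outside \<open>I\<close> are
  rejected as soon as anything is.\<close>

lemma lsu_V_eq:
  assumes "I \<subseteq> {..<n}" "\<And>i. i < n \<Longrightarrow> i \<notin> I \<Longrightarrow> p i = 0" "lsu_m \<alpha> n p \<noteq> 0" "0 \<le> \<alpha>"
  shows "lsu_V \<alpha> n I p + (n - card I) = lsu_m \<alpha> n p"
proof -
  have "lsu_rej \<alpha> n p = (lsu_rej \<alpha> n p \<inter> I) \<union> ({..<n} - I)"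
    using assms by (auto simp: lsu_rej_def)
  moreover have "card ((lsu_rej \<alpha> n p \<inter> I) \<union> ({..<n} - I)) = card (lsu_rej \<alpha> n p \<inter> I) + card ({..<n} - I)"
    by (intro card_Un_disjoint) (auto simp: lsu_rej_def)
  moreover have "card ({..<n} - I) = n - card I"
    using assms by (simp add: card_Diff_subset finite_subset)
  ultimately show ?thesis
    using lsu_R_eq[of \<alpha> n p] assms by (simp add: lsu_V_def lsu_R_def)
qed

section \<open>Convergence of the threshold for a fixed array of p-values\<close>

text \<open>Pointwise convergence of the empirical distribution functions is enough. The lower bound
  uses one point s; for the upper bound compactness of [a, \<alpha>] and monotonicity of the counts
  replace uniform convergence. The premise \<open>below\<close> asks only for points arbitrarily
  close to t, so that it also covers a crossing at \<open>lo\<close>.\<close>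

lemma lsu_threshold_tendsto:
  fixes p :: "nat \<Rightarrow> nat \<Rightarrow> real"
  assumes alpha: "0 < \<alpha>" "\<alpha> < 1" and t: "0 < t" "t \<le> \<alpha>"
    and conv: "\<And>s. 0 < s \<Longrightarrow> s < 1 \<Longrightarrow> (\<lambda>n. real (count_le n (p n) s) / real n) \<longlonglongrightarrow> H s"
    and cont: "continuous_on {0<..<1} H"
    and above: "\<And>s. t < s \<Longrightarrow> s \<le> \<alpha> \<Longrightarrow> H s < s / \<alpha>"
    and below: "\<And>a. a < t \<Longrightarrow> \<exists>s. a < s \<and> 0 < s \<and> s < t \<and> s / \<alpha> < H s"
  shows "(\<lambda>n. real (lsu_m \<alpha> n (p n)) * \<alpha> / real n) \<longlonglongrightarrow> t"
proof (rule order_tendstoI)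
  fix a assume "a < t"
  then obtain s where s: "a < s" "0 < s" "s < t" "s / \<alpha> < H s" using below by blast
  have "\<forall>\<^sub>F n in sequentially. s / \<alpha> < real (count_le n (p n) s) / real n"
    using s t alpha by (intro order_tendstoD(1)[OF conv]) auto
  then show "\<forall>\<^sub>F n in sequentially. a < real (lsu_m \<alpha> n (p n)) * \<alpha> / real n"
    using eventually_gt_at_top[of 0]
  proof eventually_elim
    case (elim n)
    then show ?case using lsu_threshold_lower[of \<alpha> n s "p n"] alpha s by simp
  qed
next
  fix a assume a: "t < a"
  \<comment> \<open>A window (r, s) around x on which monotonicity alone decides: the value of H at
    the right end is below the line at the left end. A constant c strictly between H x and x /
    \<alpha> gives r = c \<alpha>, and continuity of H gives s.\<close>
  have "\<exists>r s. r < x \<and> x < s \<and> s < 1 \<and> H s < r / \<alpha>" if x: "x \<in> {a..\<alpha>}" for x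
  proof -
    have x': "0 < x" "x < 1" "t < x" "x \<le> \<alpha>" using x a t alpha by auto
    obtain c where c: "H x < c" "c < x / \<alpha>" using dense above x' by blast
    have "isCont H x"
      using cont x' by (simp add: continuous_on_eq_continuous_at)
    then have "(H \<longlongrightarrow> H x) (at_right x)"
      by (simp add: isCont_def filterlim_at_split)
    then have "\<forall>\<^sub>F s in at_right x. H s < c"
      using c by (intro order_tendstoD(2))
    moreover have "\<forall>\<^sub>F s in at_right x. s \<in> {x<..<1}"
      using x' by (auto intro: eventually_at_rightI)
    ultimately have "\<forall>\<^sub>F s in at_right x. H s < c \<and> s \<in> {x<..<1}" by eventually_elim auto
    then obtain s where "H s < c" "x < s" "s < 1"
      using eventually_happens trivial_limit_at_right_real by fastforce
    then show ?thesis
      using c alpha by (intro exI[of _ "c * \<alpha>"] exI[of _ s]) (auto simp: field_simps)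
  qed
  then obtain r s where rs: "\<And>x. x \<in> {a..\<alpha>} \<Longrightarrow> r x < x \<and> x < s x \<and> s x < 1 \<and> H (s x) < r x / \<alpha>"
    by metis
  obtain D where D: "D \<subseteq> {a..\<alpha>}" "finite D" "{a..\<alpha>} \<subseteq> (\<Union>x\<in>D. {r x<..<s x})"
    by (rule compactE_image[of "{a..\<alpha>}" "{a..\<alpha>}" "\<lambda>x. {r x<..<s x}"]) (use rs in auto)
  have "\<forall>\<^sub>F n in sequentially. real (count_le n (p n) (s x)) / real n < r x / \<alpha>" if "x \<in> D" for x
  proof (rule order_tendstoD(2)[OF conv])
    have "x \<in> {a..\<alpha>}" using that D by blast
    then show "0 < s x" "s x < 1" "H (s x) < r x / \<alpha>"
      using rs[of x] a t by auto
  qed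
  then have "\<forall>\<^sub>F n in sequentially. \<forall>x\<in>D. real (count_le n (p n) (s x)) / real n < r x / \<alpha>"
    using D(2) by (intro eventually_ball_finite) auto
  then show "\<forall>\<^sub>F n in sequentially. real (lsu_m \<alpha> n (p n)) * \<alpha> / real n < a"
    using eventually_gt_at_top[of 0]
  proof eventually_elim
    case (elim n)
    define m where "m = lsu_m \<alpha> n (p n)"
    define u where "u = real m * \<alpha> / real n"
    show ?case
    proof (rule ccontr)
      assume "\<not> ?thesis"
      then have "a \<le> u" by (simp add: u_def m_def)
      then have "m \<noteq> 0" using a t by (intro notI) (simp add: u_def)
      have "real m / real n \<le> 1" using lsu_m_le[of \<alpha> n "p n"] elim by (simp add: m_def)
      then have "u \<le> \<alpha>" using mult_left_le[of "real m / real n" \<alpha>] alpha by (simp add: u_def mult.commute)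
      with \<open>a \<le> u\<close> D obtain x where x: "x \<in> D" "r x < u" "u < s x" by force
      \<comment> \<open>A threshold u in a window (r, s) is impossible: m/n is at most the empirical
        distribution function at s, which is below r / \<alpha> and hence below u / \<alpha> =
        m/n.\<close>
      have "real m / real n \<le> real (count_le n (p n) (s x)) / real n"
        using lsu_m_le_count[of \<alpha> n "p n"] count_le_mono[of u "s x" n "p n"] x(3)
        by (intro divide_right_mono) (auto simp: m_def u_def)
      also have "\<dots> < r x / \<alpha>" using elim x by blast
      also have "\<dots> < u / \<alpha>" using x alpha by (simp add: divide_strict_right_mono)
      also have "\<dots> = real m / real n" using alpha by (simp add: u_def)
      finally show False by simp
    qed
  qed
qed

lemma lsu_ratios_tendsto:
  fixes p :: "nat \<Rightarrow> nat \<Rightarrow> real"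
  assumes alpha: "0 < \<alpha>" and t: "0 < t"
    and m: "(\<lambda>n. real (lsu_m \<alpha> n (p n)) * \<alpha> / real n) \<longlonglongrightarrow> t"
    and I: "\<And>n. I n \<subseteq> {..<n}" and p0: "\<And>n i. i < n \<Longrightarrow> i \<notin> I n \<Longrightarrow> p n i = 0"
    and zeta: "(\<lambda>n. real (card (I n)) / real n) \<longlonglongrightarrow> \<zeta>"
  shows "(\<lambda>n. real (lsu_V \<alpha> n (I n) (p n)) / real n) \<longlonglongrightarrow> t / \<alpha> - 1 + \<zeta>"
    and "(\<lambda>n. real (lsu_V \<alpha> n (I n) (p n)) / max (real (lsu_R \<alpha> n (p n))) 1) \<longlonglongrightarrow> 1 - \<alpha> * (1 - \<zeta>) / t"
proof -
  let ?m = "\<lambda>n. real (lsu_m \<alpha> n (p n))" and ?V = "\<lambda>n. real (lsu_V \<alpha> n (I n) (p n))"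
  \<comment> \<open>A positive limit of the thresholds forces m to be nonzero eventually. From then
    on \<open>lsu_V_eq\<close> applies and the maximum with 1 in the second ratio is
    inactive.\<close>
  have ev: "\<forall>\<^sub>F n in sequentially. 0 < n \<and> lsu_m \<alpha> n (p n) \<noteq> 0 \<and> ?V n = ?m n - (real n - real (card (I n)))"
    using order_tendstoD(1)[OF m t] eventually_gt_at_top[of 0]
  proof eventually_elim
    case (elim n)
    then have "lsu_m \<alpha> n (p n) \<noteq> 0" by (intro notI) simp
    moreover have "card (I n) \<le> n" using card_mono[OF _ I[of n]] by simp
    ultimately show ?case using elim alpha lsu_V_eq[OF I[of n], of "p n" \<alpha>] p0[of _ n] by simp
  qed
  have mn: "(\<lambda>n. ?m n / real n) \<longlonglongrightarrow> t / \<alpha>"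
    using tendsto_divide[OF m tendsto_const[of \<alpha>]] alpha by simp
  have "(\<lambda>n. ?m n / real n - (1 - real (card (I n)) / real n)) \<longlonglongrightarrow> t / \<alpha> - (1 - \<zeta>)"
    by (intro tendsto_intros mn zeta)
  moreover have "\<forall>\<^sub>F n in sequentially. ?m n / real n - (1 - real (card (I n)) / real n) = ?V n / real n"
    using ev by eventually_elim (simp add: diff_divide_distrib)
  ultimately show V: "(\<lambda>n. ?V n / real n) \<longlonglongrightarrow> t / \<alpha> - 1 + \<zeta>"
    using tendsto_cong by (fastforce simp: algebra_simps)
  have "(\<lambda>n. (?V n / real n) / (?m n / real n)) \<longlonglongrightarrow> (t / \<alpha> - 1 + \<zeta>) / (t / \<alpha>)"
    using t alpha by (intro tendsto_divide V mn) auto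
  moreover have "(t / \<alpha> - 1 + \<zeta>) / (t / \<alpha>) = 1 - \<alpha> * (1 - \<zeta>) / t"
    using t alpha by (simp add: field_simps)
  moreover have "\<forall>\<^sub>F n in sequentially. (?V n / real n) / (?m n / real n) = ?V n / max (real (lsu_R \<alpha> n (p n))) 1"
    using ev by eventually_elim (use alpha in \<open>simp add: lsu_R_eq max_def\<close>)
  ultimately show "(\<lambda>n. ?V n / max (real (lsu_R \<alpha> n (p n))) 1) \<longlonglongrightarrow> 1 - \<alpha> * (1 - \<zeta>) / t"
    using tendsto_cong by fastforce
qed

section \<open>Measurability of the rejection counts\<close>

text \<open>Each counting condition becomes an inequality for a finite sum of indicators, so m is
  the maximum of a random finite set described by measurable conditions.\<close>

lemma lsu_m_measurable:
  assumes [measurable]: "\<And>i. P i \<in> borel_measurable M"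
  shows "(\<lambda>\<omega>. lsu_m \<alpha> n (\<lambda>i. P i \<omega>)) \<in> measurable M (count_space UNIV)"
proof -
  have "real (count_le n (\<lambda>i. P i \<omega>) c) = (\<Sum>i<n. if P i \<omega> \<le> c then 1 else 0)" for c \<omega>
    by (simp add: count_le_def sum.If_cases Int_def)
  then have "k \<le> count_le n (\<lambda>i. P i \<omega>) c \<longleftrightarrow> real k \<le> (\<Sum>i<n. if P i \<omega> \<le> c then 1 else 0)" for k c \<omega>
    by (metis of_nat_le_iff)
  then have "lsu_m \<alpha> n (\<lambda>i. P i \<omega>) = Max {k. k = 0 \<or> k \<in> {1..n} \<and>
      real k \<le> (\<Sum>i<n. if P i \<omega> \<le> real k * \<alpha> / real n then 1 else 0)}" for \<omega>
    unfolding lsu_m_eq by (intro arg_cong[of _ _ Max]) blast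
  then show ?thesis by (subst measurable_cong) (assumption, measurable)
qed

lemma lsu_R_measurable:
  assumes "\<And>i. P i \<in> borel_measurable M" "0 \<le> \<alpha>"
  shows "(\<lambda>\<omega>. real (lsu_R \<alpha> n (\<lambda>i. P i \<omega>))) \<in> borel_measurable M"
  using measurable_compose[OF lsu_m_measurable[OF assms(1)], of real borel] assms(2) by (simp add: lsu_R_eq)

lemma lsu_V_measurable:
  assumes [measurable]: "\<And>i. P i \<in> borel_measurable M" and I: "I \<subseteq> {..<n}"
  shows "(\<lambda>\<omega>. real (lsu_V \<alpha> n I (\<lambda>i. P i \<omega>))) \<in> borel_measurable M"
proof -
  note [measurable] = lsu_m_measurable[OF assms(1)]
  have "real (lsu_V \<alpha> n I p) = (\<Sum>i\<in>I. if lsu_m \<alpha> n p \<noteq> 0 \<and>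
      p i \<le> real (lsu_m \<alpha> n p) * \<alpha> / real n then 1 else 0)" for p
  proof -
    have "lsu_rej \<alpha> n p \<inter> I = {i \<in> I. lsu_m \<alpha> n p \<noteq> 0 \<and> p i \<le> real (lsu_m \<alpha> n p) * \<alpha> / real n}"
      using I by (auto simp: lsu_rej_def)
    then show ?thesis
      using finite_subset[OF I] by (simp add: lsu_V_def sum.If_cases Int_def)
  qed
  then show ?thesis by simp measurable
qed

section \<open>Conditional p-values\<close>

text \<open>\<open>gen_inv W u\<close> is the smallest u-quantile: continuity of W makes the infimum
  attained, which gives the equivalence with u \<le> W x.\<close>

lemma
  fixes W :: "real \<Rightarrow> real"
  assumes W: "mono W" "continuous_on UNIV W" "(W \<longlongrightarrow> 1) at_top" "(W \<longlongrightarrow> 0) at_bot"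
    and u: "0 < u" "u < 1"
  shows gen_inv_le_iff: "gen_inv W u \<le> x \<longleftrightarrow> u \<le> W x"
    and cdf_gen_inv: "W (gen_inv W u) = u"
proof -
  let ?S = "{x. u \<le> W x}"
  have "\<forall>\<^sub>F x in at_top. u < W x" using W(3) u by (intro order_tendstoD(1)) auto
  then obtain b where "u < W b" using eventually_happens trivial_limit_at_top_linorder by blast
  then have "?S \<noteq> {}" by (auto intro: less_imp_le)
  have "\<forall>\<^sub>F x in at_bot. W x < u" using W(4) u by (intro order_tendstoD(2)) auto
  then obtain a where "W a < u" using eventually_happens trivial_limit_at_bot_linorder by blast
  then have a: "a \<le> x" if "x \<in> ?S" for x
    using that monoD[OF W(1), of x a] by (cases "x \<le> a") auto
  then have bdd: "bdd_below ?S" by (rule bdd_belowI)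
  have "closed ?S"
    using W(2) by (intro closed_Collect_le continuous_on_const)
  with \<open>?S \<noteq> {}\<close> bdd have inS: "gen_inv W u \<in> ?S"
    unfolding gen_inv_def by (intro closed_contains_Inf)
  show iff: "gen_inv W u \<le> x \<longleftrightarrow> u \<le> W x" for x
  proof
    assume "gen_inv W u \<le> x"
    then show "u \<le> W x" using inS monoD[OF W(1)] by (auto intro: order_trans)
  next
    assume "u \<le> W x"
    then show "gen_inv W u \<le> x" unfolding gen_inv_def by (intro cInf_lower bdd) simp
  qed
  \<comment> \<open>To the left of the infimum W stays below u, and by continuity the bound survives
    in the limit.\<close>
  have "W (gen_inv W u) \<le> u"
  proof (rule tendsto_upperbound)
    have "isCont W (gen_inv W u)" using W(2) by (simp add: continuous_on_eq_continuous_at)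
    then show "(W \<longlongrightarrow> W (gen_inv W u)) (at_left (gen_inv W u))"
      by (simp add: isCont_def filterlim_at_split)
    have "W x \<le> u" if "x < gen_inv W u" for x
      using iff[of x] that by simp
    then show "\<forall>\<^sub>F x in at_left (gen_inv W u). W x \<le> u"
      by (auto simp: eventually_at_filter)
  qed simp
  with inS show "W (gen_inv W u) = u" by simp
qed

lemma interval_nbhd_point:
  fixes I :: "real set"
  assumes "is_interval I" "z \<in> I" "z' \<in> I" "z' \<noteq> z" "0 < d"
  obtains y where "y \<in> I" "y \<noteq> z" "dist y z < d"
proof -
  define e where "e = min (d / 2) \<bar>z' - z\<bar>"
  have e: "0 < e" "e < d" "e \<le> \<bar>z' - z\<bar>" using assms by (auto simp: e_def)
  define y where "y = (if z < z' then z + e else z - e)"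
  have "y \<in> I"
    unfolding y_def by (rule mem_is_interval_1_I[OF assms(1), of "min z z'" "max z z'"]) (use e assms in \<open>auto simp: min_def max_def\<close>)
  moreover have "y \<noteq> z" "dist y z < d" using e by (auto simp: y_def dist_real_def)
  ultimately show thesis using that by blast
qed

section \<open>The p-values for a fixed value of Z\<close>

text \<open>What remains of the probabilistic model once the outcome is fixed: distribution
  functions, and the fact that they take the values 0 and 1 outside the ranges of the
  variables.\<close>

locale pvalue_model = crossing +
  fixes Xs Ts :: "real set" and g g1 g2 :: "real \<Rightarrow> real \<Rightarrow> real" and WX WT :: "real \<Rightarrow> real"
  assumes Xs_interval: "is_interval Xs"
    and Zs_nontrivial: "\<And>z. \<exists>z'\<in>Zs. z' \<noteq> z"
    and g_cont: "continuous_on (Xs \<times> Zs) (\<lambda>(x, z). g x z)"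
    and g_range: "\<And>x z. x \<in> Xs \<Longrightarrow> z \<in> Zs \<Longrightarrow> g x z \<in> Ts"
    and g_mono1: "\<And>z. z \<in> Zs \<Longrightarrow> strict_mono_on Xs (\<lambda>x. g x z)"
    and g2_inv: "(\<forall>x\<in>Xs. \<forall>z\<in>Zs. \<forall>z'\<in>Zs. g x z = g x z') \<or>
                 (\<forall>x\<in>Xs. \<forall>z\<in>Zs. \<forall>w\<in>Ts. g x z = w \<longleftrightarrow> z = g2 x w)"
    and g1_inv: "\<And>x z w. x \<in> Xs \<Longrightarrow> z \<in> Zs \<Longrightarrow> w \<in> Ts \<Longrightarrow> g x z = w \<longleftrightarrow> x = g1 w z"
    and WX: "mono WX" "continuous_on UNIV WX" "(WX \<longlongrightarrow> 1) at_top" "(WX \<longlongrightarrow> 0) at_bot"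
    and WX_below: "\<And>x. (\<And>y. y \<in> Xs \<Longrightarrow> x < y) \<Longrightarrow> WX x = 0"
    and WX_above: "\<And>x. (\<And>y. y \<in> Xs \<Longrightarrow> y < x) \<Longrightarrow> WX x = 1"
    and WT: "mono WT" "continuous_on UNIV WT" "(WT \<longlongrightarrow> 1) at_top" "(WT \<longlongrightarrow> 0) at_bot"
    and WT_support: "\<And>w. 0 < WT w \<Longrightarrow> WT w < 1 \<Longrightarrow> w \<in> Ts"
    and F_def: "\<And>z t. z \<in> Zs \<Longrightarrow> 0 < t \<Longrightarrow> t < 1 \<Longrightarrow> F t z = 1 - WX (g1 (gen_inv WT (1 - t)) z)"
    and F_zero: "\<And>z. z \<in> Zs \<Longrightarrow> F 0 z = 0"
begin

text \<open>The critical value of the test at level t: a p-value is at most t exactly when its test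
  statistic reaches \<open>crit t\<close>.\<close>

definition crit :: "real \<Rightarrow> real" where "crit t = gen_inv WT (1 - t)"

lemma crit_le_iff: "0 < t \<Longrightarrow> t < 1 \<Longrightarrow> crit t \<le> y \<longleftrightarrow> 1 - WT y \<le> t"
  unfolding crit_def by (subst gen_inv_le_iff[OF WT]) auto

lemma WT_crit: "0 < t \<Longrightarrow> t < 1 \<Longrightarrow> WT (crit t) = 1 - t"
  unfolding crit_def by (rule cdf_gen_inv[OF WT]) auto

lemma crit_antimono: "0 < s \<Longrightarrow> s \<le> t \<Longrightarrow> t < 1 \<Longrightarrow> crit t \<le> crit s"
  by (subst crit_le_iff) (auto simp: WT_crit)

lemma crit_strict: "0 < s \<Longrightarrow> s < t \<Longrightarrow> t < 1 \<Longrightarrow> crit t < crit s"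
  using crit_antimono[of s t] WT_crit[of s] WT_crit[of t] by (cases "crit t = crit s") auto

lemma crit_in_Ts: "0 < t \<Longrightarrow> t < 1 \<Longrightarrow> crit t \<in> Ts"
  by (rule WT_support) (auto simp: WT_crit)

lemma F_eq: "z \<in> Zs \<Longrightarrow> 0 < t \<Longrightarrow> t < 1 \<Longrightarrow> F t z = 1 - WX (g1 (crit t) z)"
  by (simp add: F_def crit_def)

lemma g_less_iff: "x \<in> Xs \<Longrightarrow> y \<in> Xs \<Longrightarrow> z \<in> Zs \<Longrightarrow> g x z < g y z \<longleftrightarrow> x < y"
  using strict_mono_on_less[OF g_mono1] by blast

lemma g_le_iff: "x \<in> Xs \<Longrightarrow> y \<in> Xs \<Longrightarrow> z \<in> Zs \<Longrightarrow> g x z \<le> g y z \<longleftrightarrow> x \<le> y"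
  using g_less_iff[of y x z] by (simp add: not_less[symmetric])

lemma g_g1: "z \<in> Zs \<Longrightarrow> w \<in> Ts \<Longrightarrow> g1 w z \<in> Xs \<Longrightarrow> g (g1 w z) z = w"
  using g1_inv[of "g1 w z" z w] by simp

lemma g_cont_left: "z \<in> Zs \<Longrightarrow> continuous_on Xs (\<lambda>x. g x z)"
  using continuous_on_compose2[OF g_cont, of Xs "\<lambda>x. (x, z)"]
  by (force intro: continuous_on_Pair continuous_on_id continuous_on_const)

lemma g_cont_right: "x \<in> Xs \<Longrightarrow> continuous_on Zs (\<lambda>z. g x z)"
  using continuous_on_compose2[OF g_cont, of Zs "\<lambda>z. (x, z)"]
  by (force intro: continuous_on_Pair continuous_on_id continuous_on_const)

lemma WX_support:
  assumes "0 < WX x" "WX x < 1"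
  shows "x \<in> Xs"
proof -
  obtain a where "a \<in> Xs" "a \<le> x"
    using WX_below[of x] assms by (force simp: not_less[symmetric])
  moreover obtain b where "b \<in> Xs" "x \<le> b"
    using WX_above[of x] assms by (force simp: not_less[symmetric])
  ultimately show ?thesis by (intro mem_is_interval_1_I[OF Xs_interval, of a b x])
qed

lemma g1_crit_in_Xs:
  assumes "z \<in> Zs" "0 < t" "t < 1" "0 < F t z" "F t z < 1"
  shows "g1 (crit t) z \<in> Xs"
  by (rule WX_support) (use assms in \<open>auto simp: F_eq\<close>)

text \<open>The image of Xs under g in its first argument is an interval; if it misses w, it lies on
  one side of w.\<close>

lemma out_of_range_cases:
  assumes z: "z \<in> Zs" and w: "w \<in> Ts" "g1 w z \<notin> Xs"
  shows "(\<forall>x\<in>Xs. g x z < w) \<or> (\<forall>x\<in>Xs. w < g x z)"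
proof -
  have int: "is_interval ((\<lambda>x. g x z) ` Xs)"
    using connected_continuous_image[OF g_cont_left[OF z]] Xs_interval by (simp add: is_interval_connected_1)
  have notin: "g x z \<noteq> w" if "x \<in> Xs" for x using g1_inv[OF that z w(1)] w(2) that by metis
  show ?thesis
  proof (rule ccontr)
    assume "\<not> ?thesis"
    then obtain x y where xy: "x \<in> Xs" "y \<in> Xs" "g x z \<le> w" "w \<le> g y z"
      by (auto simp: not_less)
    have "w \<in> (\<lambda>x. g x z) ` Xs"
      by (rule mem_is_interval_1_I[OF int imageI[OF xy(1)] imageI[OF xy(2)] xy(3,4)])
    then show False using notin by auto
  qed
qed

text \<open>Outside the range of \<open>x \<mapsto> g x z\<close> the value of \<^term>\<open>g1\<close> is arbitrary outside
  \<^term>\<open>Xs\<close>, so \<^term>\<open>F\<close> could be 0 where the conditional distribution function is 1, or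
  vice versa; continuity of \<^term>\<open>F\<close> in t excludes this.\<close>

lemma F_out_of_range:
  assumes "z \<in> Zs" "0 < t" "t < 1" "g1 (crit t) z \<notin> Xs"
  shows "F t z = 0 \<or> F t z = 1"
  using g1_crit_in_Xs[of z t] F_bounds[of z t] assms by (smt (verit))

text \<open>The alternative is F s z = 1. Then F, starting from 0 at 0, takes the value 1/2 at some
  t \<le> s, and at such a t the critical value is attained by some x. But \<open>crit t\<close> is
  at least \<open>crit s\<close>, which no x reaches.\<close>

lemma F_eq_0_of_range_below:
  assumes z: "z \<in> Zs" and s: "0 < s" "s < 1" and below: "\<And>x. x \<in> Xs \<Longrightarrow> g x z < crit s"
  shows "F s z = 0"
proof (rule ccontr)
  assume "F s z \<noteq> 0"
  moreover have "g1 (crit s) z \<notin> Xs"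
    using g_g1[OF z crit_in_Ts[OF s]] below by force
  ultimately have "F s z = 1" using F_out_of_range z s by blast
  then have "\<exists>t. 0 \<le> t \<and> t \<le> s \<and> F t z = 1/2"
    using F_zero[OF z] s by (intro IVT') (auto intro: continuous_on_subset[OF F_cont[OF z]])
  then obtain t where t: "0 \<le> t" "t \<le> s" "F t z = 1/2" by blast
  then have "0 < t" using F_zero[OF z] by (cases "t = 0") auto
  then have "g1 (crit t) z \<in> Xs" "crit s \<le> crit t"
    using t s z by (auto intro!: g1_crit_in_Xs crit_antimono)
  with below[of "g1 (crit t) z"] g_g1[OF z crit_in_Ts[of t]] \<open>0 < t\<close> t s show False by simp
qed

lemma F_strict_bounds:
  assumes "z \<in> Zs" "z1 \<in> Zs" "z2 \<in> Zs" "z1 < z" "z < z2" "\<alpha> * (1 - \<zeta>) < t" "t < \<alpha>"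
  shows "0 < F t z" "F t z < 1"
proof -
  have "0 < t" "t < 1" using lo_pos assms alpha by (auto simp: lo_def)
  then have "0 \<le> F t z2" "F t z1 \<le> 1" using F_bounds assms by auto
  moreover have "F t z2 < F t z" "F t z < F t z1"
    using monotone_onD[OF F_decr] assms by blast+
  ultimately show "0 < F t z" "F t z < 1" by auto
qed

text \<open>No value of F at 1 is prescribed, so the anchor is a level t between \<open>lo\<close>
  and \<alpha>, where neighbours of z on both sides force 0 < F t z < 1. The critical value at t is
  attained, hence t < s. If F s z were 0, F would drop to half of F t z at some r between t and s;
  there the critical value is attained too, and F r z \<ge> F t z by monotonicity of g and
  WX.\<close>

lemma F_eq_1_of_range_above:
  assumes z: "z \<in> Zs" "z1 \<in> Zs" "z2 \<in> Zs" "z1 < z" "z < z2"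
    and s: "0 < s" "s < 1" and above: "\<And>x. x \<in> Xs \<Longrightarrow> crit s < g x z"
  shows "F s z = 1"
proof (rule ccontr)
  assume "F s z \<noteq> 1"
  moreover have "g1 (crit s) z \<notin> Xs"
    using g_g1[OF z(1) crit_in_Ts[OF s]] above by force
  ultimately have Fs: "F s z = 0" using F_out_of_range z s by blast
  obtain t where t: "\<alpha> * (1 - \<zeta>) < t" "t < \<alpha>" using dense lo_less by (auto simp: lo_def)
  then have t01: "0 < t" "t < 1" using lo_pos alpha by (auto simp: lo_def)
  note Ft = F_strict_bounds[OF z t]
  have x: "g1 (crit t) z \<in> Xs" using g1_crit_in_Xs z t01 Ft by blast
  have gx: "g (g1 (crit t) z) z = crit t" using g_g1[OF z(1) crit_in_Ts[OF t01] x] .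
  have "t < s"
    using crit_antimono[of s t] above[OF x] gx s t01 by force
  have "\<exists>r. t \<le> r \<and> r \<le> s \<and> F r z = F t z / 2"
    using Fs Ft \<open>t < s\<close> t01 s by (intro IVT2') (auto intro: continuous_on_subset[OF F_cont[OF z(1)]])
  then obtain r where r: "t \<le> r" "r \<le> s" "F r z = F t z / 2" by blast
  then have r01: "0 < r" "r < 1" using t01 s by auto
  have x': "g1 (crit r) z \<in> Xs" using r r01 Ft z by (intro g1_crit_in_Xs) auto
  have "g (g1 (crit r) z) z \<le> g (g1 (crit t) z) z"
    using gx g_g1[OF z(1) crit_in_Ts[OF r01] x'] crit_antimono[of t r] t01 r r01 by simp
  then have "g1 (crit r) z \<le> g1 (crit t) z" using g_le_iff x x' z by simp
  then have "F t z \<le> F r z" using monoD[OF WX(1)] F_eq z t01 r01 by simp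
  with r Ft show False by simp
qed

lemma empirical_pvalue_tendsto:
  fixes Y :: "nat \<Rightarrow> nat \<Rightarrow> real"
  assumes z: "z \<in> Zs" "z1 \<in> Zs" "z2 \<in> Zs" "z1 < z" "z < z2" and s: "0 < s" "s < 1"
    and Y: "\<And>n i. i \<in> I n \<Longrightarrow> Y n i \<in> Xs"
    and tail: "\<And>x. (\<lambda>n. real (card {i \<in> I n. x \<le> Y n i}) / real n) \<longlonglongrightarrow> \<zeta> * (1 - WX x)"
    and lim: "(\<lambda>n. real (card (I n)) / real n) \<longlonglongrightarrow> \<zeta>"
  shows "(\<lambda>n. real (card {i \<in> I n. 1 - WT (g (Y n i) z) \<le> s}) / real n) \<longlonglongrightarrow> \<zeta> * F s z"
proof (cases "g1 (crit s) z \<in> Xs")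
  case True
  then have "{i \<in> I n. 1 - WT (g (Y n i) z) \<le> s} = {i \<in> I n. g1 (crit s) z \<le> Y n i}" for n
    using g_le_iff[OF True Y z(1)] g_g1[OF z(1) crit_in_Ts[OF s] True] crit_le_iff[OF s] by auto
  then show ?thesis using tail[of "g1 (crit s) z"] F_eq z s by simp
next
  case False
  from out_of_range_cases[OF z(1) crit_in_Ts[OF s] False] show ?thesis
  proof
    assume below: "\<forall>x\<in>Xs. g x z < crit s"
    then have "{i \<in> I n. 1 - WT (g (Y n i) z) \<le> s} = {}" for n
      using Y crit_le_iff[OF s, symmetric] by (auto simp: not_le)
    then show ?thesis using F_eq_0_of_range_below[OF z(1) s] below by (simp only:) simp
  next
    assume above: "\<forall>x\<in>Xs. crit s < g x z"
    then have "{i \<in> I n. 1 - WT (g (Y n i) z) \<le> s} = I n" for n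
      using Y crit_le_iff[OF s, symmetric] by (auto intro: less_imp_le)
    then show ?thesis using F_eq_1_of_range_above[OF z s] above lim by simp
  qed
qed

text \<open>If \<^term>\<open>WX\<close> were flat to the left of the crossing point, then for \<^term>\<open>t\<close> slightly
  larger and \<^term>\<open>z\<close> near \<^term>\<open>z0\<close> the arguments of \<^term>\<open>WX\<close> would stay in the flat part,
  against the strict monotonicity of \<^term>\<open>F t\<close>.\<close>

lemma gen_inv_WX_crossing:
  assumes z0: "z0 \<in> Zs" and t: "\<alpha> * (1 - \<zeta>) < t" "t < \<alpha>" and F: "0 < F t z0" "F t z0 < 1"
  shows "gen_inv WX (1 - F t z0) = g1 (crit t) z0"
proof (rule ccontr)
  define x0 where "x0 = g1 (crit t) z0"
  define v where "v = 1 - F t z0"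
  have t01: "0 < t" "t < 1" using t lo_pos alpha by (auto simp: lo_def)
  have v: "0 < v" "v < 1" using F by (auto simp: v_def)
  have x0: "x0 \<in> Xs" unfolding x0_def using g1_crit_in_Xs z0 t01 F by blast
  have gx0: "g x0 z0 = crit t" using g_g1[OF z0 crit_in_Ts[OF t01]] x0 by (simp add: x0_def)
  have WX_x0: "WX x0 = v" using F_eq[OF z0 t01] by (simp add: x0_def v_def)
  assume "gen_inv WX (1 - F t z0) \<noteq> g1 (crit t) z0"
  then have "gen_inv WX v \<noteq> x0" by (simp add: v_def x0_def)
  moreover have "gen_inv WX v \<le> x0" using gen_inv_le_iff[OF WX v] WX_x0 by simp
  ultimately obtain y where y: "gen_inv WX v < y" "y < x0" using dense[of "gen_inv WX v" x0] by auto
  have flat: "WX x = v" if "y \<le> x" "x \<le> x0" for x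
    using monoD[OF WX(1) that(2)] gen_inv_le_iff[OF WX v, of x] that y WX_x0 by auto
  have yXs: "y \<in> Xs" using WX_support flat[of y] y v by simp
  have "g y z0 < crit t" using g_less_iff[OF yXs x0 z0] y gx0 by simp
  then have "t < 1 - WT (g y z0)" using crit_le_iff[OF t01, of "g y z0"] by linarith
  \<comment> \<open>Raising t slightly lowers the critical value below g x0 z0, yet keeps it above g
    y z0, so that it is attained strictly inside the flat stretch of WX.\<close>
  then obtain t' where t': "t < t'" "t' < \<alpha>" "t' < 1 - WT (g y z0)"
    using dense[of t "min \<alpha> (1 - WT (g y z0))"] t by auto
  then have t'01: "0 < t'" "t' < 1" using t01 alpha by auto
  define w where "w = crit t'"
  have w: "g y z0 < w" "w < g x0 z0" "w \<in> Ts"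
    using crit_le_iff[OF t'01, of "g y z0"] t' crit_strict[of t t'] t01 t'01 crit_in_Ts[OF t'01]
    by (auto simp: w_def gx0)
  obtain d1 where d1: "0 < d1" "\<And>z. z \<in> Zs \<Longrightarrow> dist z z0 < d1 \<Longrightarrow> dist (g y z) (g y z0) < w - g y z0"
    using g_cont_right[OF yXs, unfolded continuous_on_iff, rule_format, OF z0, of "w - g y z0"] w by auto
  obtain d2 where d2: "0 < d2" "\<And>z. z \<in> Zs \<Longrightarrow> dist z z0 < d2 \<Longrightarrow> dist (g x0 z) (g x0 z0) < g x0 z0 - w"
    using g_cont_right[OF x0, unfolded continuous_on_iff, rule_format, OF z0, of "g x0 z0 - w"] w by auto
  obtain z' where "z' \<in> Zs" "z' \<noteq> z0" using Zs_nontrivial by blast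
  then obtain z where z: "z \<in> Zs" "z \<noteq> z0" "dist z z0 < min d1 d2"
    using interval_nbhd_point[OF Zs_interval z0, of z' "min d1 d2"] d1(1) d2(1) by auto
  have gz: "g y z < w" "w < g x0 z"
    using d1(2)[OF z(1)] d2(2)[OF z(1)] z(3) by (auto simp: dist_real_def)
  \<comment> \<open>Stated for every z satisfying the two strict inequalities, so that it applies
    both to z0 and to its neighbour: \<open>g1 w z\<close> falls into [y, x0], where WX has the
    constant value v.\<close>
  have const: "F t' z = 1 - v" if z: "z \<in> Zs" and g: "g y z < w" "w < g x0 z" for z
  proof -
    have "{y..x0} \<subseteq> Xs"
      using mem_is_interval_1_I[OF Xs_interval yXs x0] by auto
    then have "\<exists>x. y \<le> x \<and> x \<le> x0 \<and> g x z = w"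
      using g y by (intro IVT') (auto intro: continuous_on_subset[OF g_cont_left[OF z]])
    then obtain x where x: "y \<le> x" "x \<le> x0" "g x z = w" by blast
    have "x \<in> Xs" using mem_is_interval_1_I[OF Xs_interval yXs x0] x by simp
    then have "g1 w z = x" using g1_inv[OF _ z w(3), of x] x by simp
    then show ?thesis using F_eq[OF z t'01] flat[of x] x by (simp add: w_def)
  qed
  have "F t' z = F t' z0" using const[OF z(1) gz] const[OF z0 w(1,2)] by simp
  moreover have "F t' z \<noteq> F t' z0"
    using monotone_onD[OF F_decr, of t' z z0] monotone_onD[OF F_decr, of t' z0 z] t t' z z0
    by (cases z z0 rule: linorder_cases) auto
  ultimately show False by simp
qed

text \<open>Solving the crossing equation for F shows that the quantile level (1 -
  t/\<alpha>)/\<zeta> is 1 - F t z. By \<open>gen_inv_WX_crossing\<close> its quantile is the x with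
  g x z = \<open>crit t\<close>, and \<open>g2\<close> recovers z.\<close>

lemma zcross_tcross:
  assumes z: "z \<in> Zs" and t: "lo < \<tau> z" "\<tau> z < \<alpha>"
  shows "zcross \<alpha> \<zeta> WX WT g2 (\<tau> z) = z"
proof -
  define t where "t = \<tau> z"
  have t': "\<alpha> * (1 - \<zeta>) < t" "t < \<alpha>" using assms by (auto simp: lo_def t_def)
  have t01: "0 < t" "t < 1" using t' lo_pos alpha by (auto simp: lo_def)
  have F: "1 - F t z = (1 - t / \<alpha>) / \<zeta>"
    using excess_tcross[OF z] zeta by (simp add: excess_def Fmix_def t_def field_simps)
  have "0 < (1 - t / \<alpha>) / \<zeta>" "(1 - t / \<alpha>) / \<zeta> < 1"
    using t' alpha zeta by (auto simp: field_simps)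
  then have F01: "0 < F t z" "F t z < 1" using F by auto
  define x where "x = g1 (crit t) z"
  have x: "x \<in> Xs" using g1_crit_in_Xs[OF z t01 F01] by (simp add: x_def)
  have gx: "g x z = crit t" using g_g1[OF z crit_in_Ts[OF t01]] x by (simp add: x_def)
  \<comment> \<open>If g did not depend on z, neither would F at level t, against strict decrease;
    hence the inverse \<open>g2\<close> is available.\<close>
  have "\<not> (\<forall>x\<in>Xs. \<forall>z\<in>Zs. \<forall>z'\<in>Zs. g x z = g x z')"
  proof
    assume const: "\<forall>x\<in>Xs. \<forall>z\<in>Zs. \<forall>z'\<in>Zs. g x z = g x z'"
    obtain z' where z': "z' \<in> Zs" "z' \<noteq> z" using Zs_nontrivial by blast
    have "g x z' = crit t" using const x z z' gx by metis
    then have "g1 (crit t) z' = x" using g1_inv[OF x z'(1) crit_in_Ts[OF t01]] by simp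
    then have "F t z' = F t z" using F_eq z z' t01 by (simp add: x_def)
    moreover have "F t z' \<noteq> F t z"
      using monotone_onD[OF F_decr, of t z z'] monotone_onD[OF F_decr, of t z' z] t' z z'
      by (cases z z' rule: linorder_cases) auto
    ultimately show False by simp
  qed
  with g2_inv have "\<forall>x\<in>Xs. \<forall>z\<in>Zs. \<forall>w\<in>Ts. g x z = w \<longleftrightarrow> z = g2 x w" by blast
  then have "g2 x (crit t) = z" using x z gx crit_in_Ts[OF t01] by metis
  then show ?thesis
    using gen_inv_WX_crossing[OF z t' F01] F by (simp add: zcross_def t_def[symmetric] crit_def[symmetric] x_def)
qed

text \<open>If the crossing point is \<^term>\<open>\<alpha>\<close> itself, it need not be an LCP for this particular
  \<^term>\<open>z\<close>, but then all true hypotheses have p-values below \<^term>\<open>\<alpha>\<close>, so everything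
  is rejected.\<close>

lemma pvalues_le_alpha:
  assumes z: "z \<in> Zs" "F \<alpha> z = 1" and x: "x \<in> Xs" "0 < WX x"
  shows "1 - WT (g x z) \<le> \<alpha>"
proof (cases "g1 (crit \<alpha>) z \<in> Xs")
  case True
  have "WX (g1 (crit \<alpha>) z) = 0" using F_eq[OF z(1) alpha] z by simp
  then have "g1 (crit \<alpha>) z \<le> x"
    using x monoD[OF WX(1), of x "g1 (crit \<alpha>) z"] by (cases "x \<le> g1 (crit \<alpha>) z") auto
  then have "crit \<alpha> \<le> g x z"
    using g_le_iff[OF True x(1) z(1)] g_g1[OF z(1) crit_in_Ts[OF alpha] True] by simp
  then show ?thesis using crit_le_iff[OF alpha] by simp
next
  case False
  from out_of_range_cases[OF z(1) crit_in_Ts[OF alpha] False] show ?thesis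
  proof
    assume "\<forall>x\<in>Xs. g x z < crit \<alpha>"
    then have "F \<alpha> z = 0" using F_eq_0_of_range_below z alpha by blast
    then show ?thesis using z by simp
  next
    assume "\<forall>x\<in>Xs. crit \<alpha> < g x z"
    then show ?thesis using crit_le_iff[OF alpha, of "g x z"] x by force
  qed
qed

lemma lsu_threshold_tendsto_tcross:
  fixes p Y :: "nat \<Rightarrow> nat \<Rightarrow> real"
  assumes z: "z \<in> Zs" "z1 \<in> Zs" "z2 \<in> Zs" "z1 < z" "z < z2" and D: "z \<in> D_set \<alpha> \<zeta> F Zs"
    and Y: "\<And>n i. i \<in> I n \<Longrightarrow> Y n i \<in> Xs" "\<And>n i. i \<in> I n \<Longrightarrow> 0 < WX (Y n i)"
    and tail: "\<And>x. (\<lambda>n. real (card {i \<in> I n. x \<le> Y n i}) / real n) \<longlonglongrightarrow> \<zeta> * (1 - WX x)"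
    and I: "\<And>n. I n \<subseteq> {..<n}"
    and lim: "(\<lambda>n. real (card (I n)) / real n) \<longlonglongrightarrow> \<zeta>"
    and p: "\<And>n i. i \<in> I n \<Longrightarrow> p n i = 1 - WT (g (Y n i) z)"
    and p0: "\<And>n i. i < n \<Longrightarrow> i \<notin> I n \<Longrightarrow> p n i = 0"
  shows "(\<lambda>n. real (lsu_m \<alpha> n (p n)) * \<alpha> / real n) \<longlonglongrightarrow> \<tau> z"
proof (cases "\<tau> z = \<alpha>")
  case True
  then have "F \<alpha> z = 1"
    using excess_tcross[OF z(1)] zeta alpha by (simp add: excess_def Fmix_def algebra_simps)
  then have "{i \<in> I n. p n i \<le> \<alpha>} = I n" for n
    using pvalues_le_alpha z(1) Y p by auto
  then have "count_le n (p n) \<alpha> = n" for n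
    using count_le_eq[OF I[of n], of "p n" \<alpha>] p0[of _ n] alpha card_mono[OF _ I[of n]] by simp
  then have "lsu_m \<alpha> n (p n) = n" for n
    using lsu_m_upper[of n n "p n" \<alpha>] lsu_m_le[of \<alpha> n "p n"] by (cases "n = 0") auto
  then have "\<forall>\<^sub>F n in sequentially. real (lsu_m \<alpha> n (p n)) * \<alpha> / real n = \<alpha>"
    by (intro eventually_mono[OF eventually_gt_at_top[of "0::nat"]]) simp
  then show ?thesis unfolding True by (rule tendsto_eventually)
next
  case False
  then have lt: "\<tau> z < \<alpha>" and ge: "lo \<le> \<tau> z" using tcross_le_alpha tcross_ge_lo z(1) by force+
  have Fm: "continuous_on {0<..<1} (\<lambda>s. Fmix \<zeta> F s z)"
    unfolding Fmix_def by (intro continuous_intros continuous_on_subset[OF F_cont[OF z(1)]]) auto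
  show ?thesis
  proof (rule lsu_threshold_tendsto[where H = "\<lambda>s. Fmix \<zeta> F s z", OF alpha _ _ _ Fm])
    show "0 < \<tau> z" "\<tau> z \<le> \<alpha>" using lt ge lo_pos by auto
  next
    fix s :: real assume s: "0 < s" "s < 1"
    have "(\<lambda>n. real (card {i \<in> I n. 1 - WT (g (Y n i) z) \<le> s}) / real n + (1 - real (card (I n)) / real n))
        \<longlonglongrightarrow> \<zeta> * F s z + (1 - \<zeta>)"
      by (intro tendsto_intros lim empirical_pvalue_tendsto[OF z s Y(1) tail lim])
    moreover have "\<forall>\<^sub>F n in sequentially.
        real (card {i \<in> I n. 1 - WT (g (Y n i) z) \<le> s}) / real n + (1 - real (card (I n)) / real n)
        = real (count_le n (p n) s) / real n"
      using eventually_gt_at_top[of "0::nat"]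
    proof eventually_elim
      case (elim n)
      have "{i \<in> I n. p n i \<le> s} = {i \<in> I n. 1 - WT (g (Y n i) z) \<le> s}" using p by auto
      then have "real (count_le n (p n) s) =
          real (card {i \<in> I n. 1 - WT (g (Y n i) z) \<le> s}) + (real n - real (card (I n)))"
        using count_le_eq[OF I[of n], of "p n" s] p0[of _ n] s card_mono[OF _ I[of n]] by simp
      then show ?case using elim by (simp add: add_divide_distrib diff_divide_distrib)
    qed
    ultimately show "(\<lambda>n. real (count_le n (p n) s) / real n) \<longlonglongrightarrow> Fmix \<zeta> F s z"
      unfolding Fmix_def by (subst (asm) tendsto_cong) (simp_all add: add.commute)
  next
    fix s assume "\<tau> z < s" "s \<le> \<alpha>"
    then show "Fmix \<zeta> F s z < s / \<alpha>" using excess_neg[OF z(1)] by (simp add: excess_def)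
  next
    fix a assume a: "a < \<tau> z"
    show "\<exists>s. a < s \<and> 0 < s \<and> s < \<tau> z \<and> s / \<alpha> < Fmix \<zeta> F s z"
    proof (cases "\<tau> z = lo")
      case True
      \<comment> \<open>Below \<open>lo\<close> the line s/\<alpha> lies under 1 - \<zeta>, the mass
        that the zero p-values contribute at every positive level; no LCP property of z is
        used.\<close>
      obtain s where s: "max 0 a < s" "s < lo" using dense[of "max 0 a" lo] a True lo_pos by auto
      have "s / \<alpha> < 1 - \<zeta>" using s alpha by (simp add: lo_def field_simps)
      also have "\<dots> \<le> Fmix \<zeta> F s z"
        using F_bounds[OF z(1), of s] s lo_less alpha zeta by (simp add: Fmix_def)
      finally show ?thesis using s True by auto
    next
      case False
      with ge have gt: "lo < \<tau> z" by simp
      \<comment> \<open>Membership in \<open>D_set\<close> yields an LCP for some z' with the same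
        crossing point; since that point is interior, z' = z.\<close>
      from D obtain z' where z': "z' \<in> Zs" "is_LCP \<alpha> \<zeta> F z' (\<tau> z')" "\<tau> z' = \<tau> z"
        by (auto simp: D_set_def LCP_set_def)
      then have "is_LCP \<alpha> \<zeta> F z (\<tau> z)" using tcross_inj[OF z(1) z'(1) gt lt] by simp
      then obtain e where e: "e > 0" "\<forall>s\<in>{\<tau> z - e..<\<tau> z}. s / \<alpha> < Fmix \<zeta> F s z"
        unfolding is_LCP_def by blast
      obtain s where "max (max 0 a) (\<tau> z - e) < s" "s < \<tau> z"
        using dense[of "max (max 0 a) (\<tau> z - e)" "\<tau> z"] a e gt lo_pos by auto
      then show ?thesis using e by auto
    qed
  qed
qed

lemma lsu_ratios_tendsto_tcross:
  fixes p Y :: "nat \<Rightarrow> nat \<Rightarrow> real"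
  assumes z: "z \<in> Zs" "z1 \<in> Zs" "z2 \<in> Zs" "z1 < z" "z < z2" and D: "z \<in> D_set \<alpha> \<zeta> F Zs"
    and Y: "\<And>n i. i \<in> I n \<Longrightarrow> Y n i \<in> Xs" "\<And>n i. i \<in> I n \<Longrightarrow> 0 < WX (Y n i)"
    and tail: "\<And>x. (\<lambda>n. real (card {i \<in> I n. x \<le> Y n i}) / real n) \<longlonglongrightarrow> \<zeta> * (1 - WX x)"
    and I: "\<And>n. I n \<subseteq> {..<n}"
    and lim: "(\<lambda>n. real (card (I n)) / real n) \<longlonglongrightarrow> \<zeta>"
    and p: "\<And>n i. i \<in> I n \<Longrightarrow> p n i = 1 - WT (g (Y n i) z)"
    and p0: "\<And>n i. i < n \<Longrightarrow> i \<notin> I n \<Longrightarrow> p n i = 0"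
  shows "(\<lambda>n. real (lsu_V \<alpha> n (I n) (p n)) / real n) \<longlonglongrightarrow> \<tau> z / \<alpha> - 1 + \<zeta>"
    and "(\<lambda>n. real (lsu_V \<alpha> n (I n) (p n)) / max (real (lsu_R \<alpha> n (p n))) 1)
           \<longlonglongrightarrow> 1 - \<alpha> * (1 - \<zeta>) / \<tau> z"
  using lsu_ratios_tendsto[OF alpha(1) _ lsu_threshold_tendsto_tcross[OF assms] I p0 lim]
    tcross_ge_lo[OF z(1)] lo_pos by auto

end

section \<open>Empirical distributions and limits\<close>

text \<open>Nothing is assumed about the joint law of different rows, so a strong law for a single
  sequence does not apply. Hoeffding's bounds are summable over n, and the Borel-Cantelli lemma
  works under any dependence between rows.\<close>

lemma (in prob_space) empirical_prob_tendsto: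
  fixes X :: "nat \<Rightarrow> nat \<Rightarrow> 'a \<Rightarrow> real"
  assumes indep: "\<And>n. indep_vars (\<lambda>_. borel) (X n) (I n)"
    and I: "\<And>n. I n \<subseteq> {..<n}"
    and lim: "(\<lambda>n. real (card (I n)) / real n) \<longlonglongrightarrow> \<zeta>"
    and B[measurable]: "B \<in> sets borel"
    and q: "\<And>n i. i \<in> I n \<Longrightarrow> prob {\<omega> \<in> space M. X n i \<omega> \<in> B} = q"
  shows "AE \<omega> in M. (\<lambda>n. real (card {i \<in> I n. X n i \<omega> \<in> B}) / real n) \<longlonglongrightarrow> \<zeta> * q"
proof -
  have fin: "finite (I n)" for n using I finite_subset by blast
  have card_le: "card (I n) \<le> n" for n using card_mono[OF _ I[of n]] by simp
  have [measurable]: "X n i \<in> borel_measurable M" if "i \<in> I n" for n i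
    using indep[of n] that by (simp add: indep_vars_def)
  define Y where "Y n i \<omega> = (indicator B (X n i \<omega>) :: real)" for n i \<omega>
  have [measurable]: "Y n i \<in> borel_measurable M" if "i \<in> I n" for n i
    using that unfolding Y_def by measurable
  have sumY: "(\<Sum>i\<in>I n. Y n i \<omega>) = real (card {i \<in> I n. X n i \<omega> \<in> B})" for n \<omega>
    using fin[of n] by (simp add: Y_def indicator_def sum.If_cases Int_def)
  have EY: "expectation (Y n i) = q" if "i \<in> I n" for n i
  proof -
    have "expectation (Y n i) = expectation (indicator {\<omega> \<in> space M. X n i \<omega> \<in> B})"
      by (intro Bochner_Integration.integral_cong) (auto simp: Y_def indicator_def)
    also have "\<dots> = prob {\<omega> \<in> space M. X n i \<omega> \<in> B}"
      using that by simp
    finally show ?thesis using q[OF that] by simp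
  qed
  define A where "A e n = {\<omega> \<in> space M. e * real n \<le> \<bar>(\<Sum>i\<in>I n. Y n i \<omega>) - real (card (I n)) * q\<bar>}" for e n
  have A_sets: "A e n \<in> events" for e n
    unfolding A_def by measurable
  have A_prob: "prob (A e n) \<le> 2 * exp (- 2 * e\<^sup>2) ^ n" if e: "0 < e" for e n
  proof (cases "card (I n) = 0")
    case True
    then have "I n = {}" using fin by simp
    then have "n \<noteq> 0 \<Longrightarrow> A e n = {}" using e by (auto simp: A_def mult_le_0_iff)
    then show ?thesis using prob_le_1[of "A e 0"] by (cases "n = 0") (auto simp del: prob_le_1)
  next
    case False
    interpret H: Hoeffding_ineq M "I n" "Y n" "\<lambda>_. 0" "\<lambda>_. 1" "real (card (I n)) * q"
    proof unfold_locales
      show "indep_vars (\<lambda>_. borel) (Y n) (I n)"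
        unfolding Y_def by (rule indep_vars_compose2[OF indep]) simp
    qed (use fin EY in \<open>auto simp: Y_def indicator_def\<close>)
    have "prob (A e n) \<le> 2 * exp (- 2 * (e * real n)\<^sup>2 / real (card (I n)))"
      using H.Hoeffding_ineq_abs_ge[of "e * real n"] e False by (simp add: A_def)
    \<comment> \<open>Since \<open>card (I n)\<close> is at most n, dividing by it only improves the
      exponent; the bound becomes geometric in n.\<close>
    also have "\<dots> \<le> 2 * exp (- 2 * e\<^sup>2 * real n)"
    proof -
      have "e\<^sup>2 * real n * real (card (I n)) \<le> e\<^sup>2 * real n * real n"
        using card_le[of n] by (intro mult_left_mono) auto
      then show ?thesis using False by (simp add: field_simps power2_eq_square)
    qed
    also have "\<dots> = 2 * exp (- 2 * e\<^sup>2) ^ n"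
      by (simp add: exp_of_nat2_mult[symmetric] mult.commute)
    finally show ?thesis .
  qed
  have "AE \<omega> in M. \<forall>\<^sub>F n in sequentially. \<omega> \<in> space M - A e n" if e: "0 < e" for e
  proof (rule borel_cantelli_AE1[OF A_sets])
    have "summable (\<lambda>n. 2 * exp (- 2 * e\<^sup>2) ^ n)"
      using e by (intro summable_mult summable_geometric) simp
    then show "summable (\<lambda>n. prob (A e n))"
      by (rule summable_comparison_test'[where N = 0]) (use A_prob[OF e] in simp)
  qed (simp add: less_top[symmetric])
  then have "AE \<omega> in M. \<forall>k. \<forall>\<^sub>F n in sequentially. \<omega> \<in> space M - A (inverse (real (Suc k))) n"
    by (simp add: AE_all_countable)
  then show ?thesis
  proof eventually_elim
    case (elim \<omega>)
    let ?c = "\<lambda>n. real (card {i \<in> I n. X n i \<omega> \<in> B})"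
    have "(\<lambda>n. ?c n / real n - real (card (I n)) / real n * q) \<longlonglongrightarrow> 0"
    proof (rule tendstoI)
      fix e :: real assume "0 < e"
      then obtain k where k: "inverse (real (Suc k)) < e" using reals_Archimedean by blast
      show "\<forall>\<^sub>F n in sequentially. dist (?c n / real n - real (card (I n)) / real n * q) 0 < e"
        using elim[rule_format, of k] eventually_gt_at_top[of 0]
      proof eventually_elim
        case (elim n)
        then have "\<bar>?c n - real (card (I n)) * q\<bar> < inverse (real (Suc k)) * real n"
          by (auto simp: A_def sumY)
        also have "\<dots> \<le> e * real n" using k by (intro mult_right_mono) auto
        finally have "\<bar>?c n - real (card (I n)) * q\<bar> / real n < e"
          using elim by (simp add: divide_less_eq)
        moreover have "?c n / real n - real (card (I n)) / real n * q = (?c n - real (card (I n)) * q) / real n"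
          by (simp add: diff_divide_distrib)
        ultimately show ?case by (simp add: abs_divide)
      qed
    qed
    from tendsto_add[OF this tendsto_mult[OF lim tendsto_const[of q]]]
    show ?case by simp
  qed
qed

text \<open>The cut-offs will depend on the outcome, so one null set has to serve all x. It is built
  from the rationals; the proportion of observations below x is then squeezed between those at
  rationals on either side, by continuity of W.\<close>

lemma (in prob_space) empirical_tail_tendsto:
  fixes X :: "nat \<Rightarrow> nat \<Rightarrow> 'a \<Rightarrow> real"
  assumes indep: "\<And>n. indep_vars (\<lambda>_. borel) (X n) (I n)"
    and I: "\<And>n. I n \<subseteq> {..<n}"
    and lim: "(\<lambda>n. real (card (I n)) / real n) \<longlonglongrightarrow> \<zeta>"
    and W: "\<And>n i x. i \<in> I n \<Longrightarrow> prob {\<omega> \<in> space M. X n i \<omega> \<le> x} = W x"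
    and W_cont: "continuous_on UNIV W"
  shows "AE \<omega> in M. \<forall>x. (\<lambda>n. real (card {i \<in> I n. x \<le> X n i \<omega>}) / real n) \<longlonglongrightarrow> \<zeta> * (1 - W x)"
proof -
  have fin: "finite (I n)" for n using I finite_subset by blast
  have "AE \<omega> in M. (\<lambda>n. real (card {i \<in> I n. X n i \<omega> \<in> {..x}}) / real n) \<longlonglongrightarrow> \<zeta> * W x" for x
    by (rule empirical_prob_tendsto[OF indep I lim]) (use W in auto)
  then have "AE \<omega> in M. \<forall>x\<in>\<rat>. (\<lambda>n. real (card {i \<in> I n. X n i \<omega> \<le> x}) / real n) \<longlonglongrightarrow> \<zeta> * W x"
    by (subst AE_ball_countable[OF countable_rat]) simp
  then show ?thesis
  proof eventually_elim
    case (elim \<omega>)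
    show ?case
    proof
      fix x
      let ?c = "\<lambda>x n. real (card {i \<in> I n. X n i \<omega> \<le> x}) / real n"
      let ?d = "\<lambda>n. real (card {i \<in> I n. X n i \<omega> < x}) / real n"
      have cont: "isCont (\<lambda>y. \<zeta> * W y) x"
        using W_cont by (simp add: continuous_on_eq_continuous_at)
      have d: "?d \<longlonglongrightarrow> \<zeta> * W x"
      proof (rule order_tendstoI)
        fix a assume "a < \<zeta> * W x"
        then have "\<forall>\<^sub>F y in at x. a < \<zeta> * W y"
          using cont by (intro order_tendstoD(1)) (auto simp: isCont_def)
        then have "\<forall>\<^sub>F y in at_left x. a < \<zeta> * W y" by (simp add: eventually_at_split)
        then obtain b where b: "b < x" "\<And>y. b < y \<Longrightarrow> y < x \<Longrightarrow> a < \<zeta> * W y"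
          by (auto simp: eventually_at_left_field)
        obtain y where y: "y \<in> \<rat>" "b < y" "y < x" using Rats_dense_in_real b(1) by blast
        have "\<forall>\<^sub>F n in sequentially. a < ?c y n"
          using elim y b by (intro order_tendstoD(1)) auto
        then show "\<forall>\<^sub>F n in sequentially. a < ?d n"
        proof eventually_elim
          case (elim n)
          have "?c y n \<le> ?d n"
            using y fin by (intro divide_right_mono of_nat_mono card_mono) auto
          with elim show ?case by simp
        qed
      next
        fix a assume "\<zeta> * W x < a"
        then have "\<forall>\<^sub>F y in at x. \<zeta> * W y < a"
          using cont by (intro order_tendstoD(2)) (auto simp: isCont_def)
        then have "\<forall>\<^sub>F y in at_right x. \<zeta> * W y < a" by (simp add: eventually_at_split)
        then obtain b where b: "x < b" "\<And>y. x < y \<Longrightarrow> y < b \<Longrightarrow> \<zeta> * W y < a"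
          by (auto simp: eventually_at_right_field)
        obtain y where y: "y \<in> \<rat>" "x < y" "y < b" using Rats_dense_in_real b(1) by blast
        have "\<forall>\<^sub>F n in sequentially. ?c y n < a"
          using elim y b by (intro order_tendstoD(2)) auto
        then show "\<forall>\<^sub>F n in sequentially. ?d n < a"
        proof eventually_elim
          case (elim n)
          have "?d n \<le> ?c y n"
            using y fin by (intro divide_right_mono of_nat_mono card_mono) auto
          with elim show ?case by simp
        qed
      qed
      have "real (card {i \<in> I n. x \<le> X n i \<omega>}) / real n = real (card (I n)) / real n - ?d n" for n
      proof -
        have "card (I n) = card ({i \<in> I n. x \<le> X n i \<omega>} \<union> {i \<in> I n. X n i \<omega> < x})"
          by (rule arg_cong[of _ _ card]) auto
        also have "\<dots> = card {i \<in> I n. x \<le> X n i \<omega>} + card {i \<in> I n. X n i \<omega> < x}"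
          using fin by (intro card_Un_disjoint) auto
        finally show ?thesis by (simp add: diff_divide_distrib[symmetric])
      qed
      then show "(\<lambda>n. real (card {i \<in> I n. x \<le> X n i \<omega>}) / real n) \<longlonglongrightarrow> \<zeta> * (1 - W x)"
        using tendsto_diff[OF lim d] by (simp add: right_diff_distrib)
    qed
  qed
qed

section \<open>Independence, distribution functions and bounded limits\<close>

text \<open>Independence is given for a family over an option type, with \<open>None\<close>
  standing for Z. This transfers it to the observations alone and to the pair of one observation and
  Z.\<close>

lemma (in prob_space) indep_vars_reindex:
  assumes ind: "indep_vars N X (f ` I)" and f: "inj_on f I"
  shows "indep_vars (\<lambda>i. N (f i)) (\<lambda>i. X (f i)) I"
  unfolding indep_vars_def2
proof (intro conjI ballI indep_setsI)
  fix i assume "i \<in> I"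
  then show rv: "random_variable (N (f i)) (X (f i))" using ind by (auto simp: indep_vars_def2)
  show "{X (f i) -` A \<inter> space M |A. A \<in> sets (N (f i))} \<subseteq> events"
    using measurable_sets[OF rv] by auto
next
  fix A J assume J: "J \<noteq> {}" "J \<subseteq> I" "finite J"
    and A: "\<forall>j\<in>J. A j \<in> {X (f j) -` A \<inter> space M |A. A \<in> sets (N (f j))}"
  have inj: "inj_on f J" using f J(2) by (rule inj_on_subset)
  define B where "B = A \<circ> the_inv_into J f"
  have B: "B (f j) = A j" if "j \<in> J" for j
    using that inj by (simp add: B_def the_inv_into_f_f)
  have "prob (\<Inter>k\<in>f ` J. B k) = (\<Prod>k\<in>f ` J. prob (B k))"
  proof (rule indep_setsD)
    show "indep_sets (\<lambda>i. {X i -` A \<inter> space M |A. A \<in> sets (N i)}) (f ` I)"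
      using ind by (simp add: indep_vars_def2)
  qed (use J A B in auto)
  moreover have "(\<Inter>k\<in>f ` J. B k) = (\<Inter>j\<in>J. A j)" using B by auto
  moreover have "(\<Prod>k\<in>f ` J. prob (B k)) = (\<Prod>j\<in>J. prob (A j))"
    using B inj by (simp add: prod.reindex)
  ultimately show "prob (\<Inter>j\<in>J. A j) = (\<Prod>j\<in>J. prob (A j))" by simp
qed

lemma (in prob_space)
  fixes X :: "'a \<Rightarrow> real"
  assumes X: "random_variable borel X" and W: "\<And>x. prob {\<omega> \<in> space M. X \<omega> \<le> x} = W x"
  shows cdf_mono: "mono W"
    and cdf_at_top: "(W \<longlongrightarrow> 1) at_top"
    and cdf_at_bot: "(W \<longlongrightarrow> 0) at_bot"
    and cdf_continuous_iff: "continuous_on UNIV W \<longleftrightarrow> (\<forall>x. prob {\<omega> \<in> space M. X \<omega> = x} = 0)"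
    and cdf_bounds: "0 \<le> W x \<and> W x \<le> 1"
proof -
  interpret D: real_distribution "distr M borel X" using X by simp
  have meas: "measure (distr M borel X) A = prob {\<omega> \<in> space M. X \<omega> \<in> A}" if "A \<in> sets borel" for A
    using X that by (simp add: measure_distr vimage_def Int_def conj_commute)
  have cdf: "cdf (distr M borel X) = W"
    using W by (auto simp: cdf_def meas)
  show "mono W" using D.cdf_nondecreasing by (auto simp: mono_def cdf)
  show "(W \<longlongrightarrow> 1) at_top" using D.cdf_lim_at_top_prob by (simp add: cdf)
  show "(W \<longlongrightarrow> 0) at_bot" using D.cdf_lim_at_bot by (simp add: cdf)
  show "continuous_on UNIV W \<longleftrightarrow> (\<forall>x. prob {\<omega> \<in> space M. X \<omega> = x} = 0)"
    using D.isCont_cdf by (simp add: continuous_on_eq_continuous_at cdf meas)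
  show "0 \<le> W x \<and> W x \<le> 1"
    using D.cdf_nonneg[of x] D.cdf_bounded_prob[of x] by (simp add: cdf)
qed

text \<open>The zeros of W, if any, have a largest element because W is continuous. It is still a
  zero, so X exceeds it almost surely. The result feeds \<open>pvalues_le_alpha\<close>.\<close>

lemma (in prob_space) AE_cdf_pos:
  fixes X :: "'a \<Rightarrow> real"
  assumes X: "random_variable borel X" and W: "\<And>x. prob {\<omega> \<in> space M. X \<omega> \<le> x} = W x"
    and cont: "continuous_on UNIV W"
  shows "AE \<omega> in M. 0 < W (X \<omega>)"
proof (cases "\<exists>x. W x = 0")
  case True
  let ?S = "{x. W x = 0}"
  have "\<forall>\<^sub>F x in at_top. 0 < W x"
    using cdf_at_top[OF X W] by (intro order_tendstoD(1)) auto
  then obtain b where b: "0 < W b" using eventually_happens trivial_limit_at_top_linorder by blast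
  have le_b: "x \<le> b" if "W x = 0" for x
    using monoD[OF cdf_mono[OF X W], of b x] that b by (cases "b \<le> x") auto
  then have bdd: "bdd_above ?S" by (intro bdd_aboveI) blast
  have "closed ?S" using cont by (intro closed_Collect_eq continuous_on_const)
  with True bdd have "Sup ?S \<in> ?S" by (intro closed_contains_Sup) auto
  then have "prob {\<omega> \<in> space M. X \<omega> \<le> Sup ?S} = 0" using W by simp
  then have "AE \<omega> in M. \<not> X \<omega> \<le> Sup ?S"
    using X by (subst AE_iff_measurable[OF _ refl]) (auto simp: emeasure_eq_measure)
  then show ?thesis
  proof eventually_elim
    case (elim \<omega>)
    then have "W (X \<omega>) \<noteq> 0" using cSup_upper[OF _ bdd, of "X \<omega>"] by auto
    then show ?case using cdf_bounds[OF X W, of "X \<omega>"] by simp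
  qed
next
  case False
  then have "0 < W x" for x using cdf_bounds[OF X W, of x] by (metis order_le_less)
  then show ?thesis by simp
qed

text \<open>The second claim yields the continuity of WT. For fixed z injectivity leaves at most one
  x with g x z = w, a null set for X; by independence Fubini's theorem integrates these sections
  over the law of Z.\<close>

lemma (in prob_space)
  fixes X Z :: "'a \<Rightarrow> real" and g :: "real \<Rightarrow> real \<Rightarrow> real"
  assumes S: "Xs \<in> sets borel" "Zs \<in> sets borel"
    and g: "continuous_on (Xs \<times> Zs) (\<lambda>(x, z). g x z)"
    and rv[measurable]: "random_variable borel X" "random_variable borel Z"
    and ran: "\<And>\<omega>. \<omega> \<in> space M \<Longrightarrow> X \<omega> \<in> Xs" "\<And>\<omega>. \<omega> \<in> space M \<Longrightarrow> Z \<omega> \<in> Zs"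
  shows measurable_continuous_pair: "random_variable borel (\<lambda>\<omega>. g (X \<omega>) (Z \<omega>))"
    and continuous_pair_no_atom:
      "indep_var borel X borel Z \<Longrightarrow> (\<And>x. prob {\<omega> \<in> space M. X \<omega> = x} = 0) \<Longrightarrow>
       (\<And>z. z \<in> Zs \<Longrightarrow> inj_on (\<lambda>x. g x z) Xs) \<Longrightarrow> prob {\<omega> \<in> space M. g (X \<omega>) (Z \<omega>) = w} = 0"
proof -
  have "(\<lambda>\<omega>. (X \<omega>, Z \<omega>)) \<in> measurable M (restrict_space borel (Xs \<times> Zs))"
    using ran by (intro measurable_restrict_space2) auto
  from measurable_compose[OF this borel_measurable_continuous_on_restrict[OF g]]
  show "random_variable borel (\<lambda>\<omega>. g (X \<omega>) (Z \<omega>))" by simp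
  assume ind: "indep_var borel X borel Z" and no_atom: "\<And>x. prob {\<omega> \<in> space M. X \<omega> = x} = 0"
    and inj: "\<And>z. z \<in> Zs \<Longrightarrow> inj_on (\<lambda>x. g x z) Xs"
  define A where "A = {q \<in> Xs \<times> Zs. (\<lambda>(x, z). g x z) q = w}"
  have "closedin (top_of_set (Xs \<times> Zs)) A"
    unfolding A_def by (rule continuous_closedin_preimage_constant[OF g])
  then obtain T where "closed T" "A = (Xs \<times> Zs) \<inter> T" by (auto simp: closedin_closed)
  moreover have "Xs \<times> Zs \<in> sets (borel \<Otimes>\<^sub>M borel)" using S by (rule pair_measureI)
  moreover have "T \<in> sets (borel \<Otimes>\<^sub>M borel)"
    using \<open>closed T\<close> unfolding borel_prod by (rule borel_closed)
  ultimately have A: "A \<in> sets (borel \<Otimes>\<^sub>M borel)" by (metis sets.Int)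
  interpret DX: prob_space "distr M borel X" by (rule prob_space_distr) simp
  interpret DZ: prob_space "distr M borel Z" by (rule prob_space_distr) simp
  interpret pair_sigma_finite "distr M borel X" "distr M borel Z" ..
  have sec: "emeasure (distr M borel X) ((\<lambda>x. (x, z)) -` A) = 0" for z
  proof -
    have pt: "emeasure (distr M borel X) {x} = 0" for x
    proof -
      have "X -` {x} \<inter> space M = {\<omega> \<in> space M. X \<omega> = x}" by auto
      then show ?thesis using no_atom[of x] by (simp add: emeasure_distr emeasure_eq_measure)
    qed
    have "\<exists>x. (\<lambda>x. (x, z)) -` A \<subseteq> {x}"
    proof (cases "(\<lambda>x. (x, z)) -` A = {}")
      case False
      then obtain x where x: "(x, z) \<in> A" by auto
      have "y = x" if "(y, z) \<in> A" for y
        using that x inj[of z] by (auto simp: A_def inj_on_def)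
      then show ?thesis by auto
    qed auto
    then obtain x where "(\<lambda>x. (x, z)) -` A \<subseteq> {x}" ..
    then have "emeasure (distr M borel X) ((\<lambda>x. (x, z)) -` A) \<le> emeasure (distr M borel X) {x}"
      by (intro emeasure_mono) auto
    with pt show ?thesis by simp
  qed
  have "emeasure M {\<omega> \<in> space M. g (X \<omega>) (Z \<omega>) = w} = emeasure M ((\<lambda>\<omega>. (X \<omega>, Z \<omega>)) -` A \<inter> space M)"
    using ran by (intro arg_cong[of _ _ "emeasure M"]) (auto simp: A_def)
  also have "\<dots> = emeasure (distr M (borel \<Otimes>\<^sub>M borel) (\<lambda>\<omega>. (X \<omega>, Z \<omega>))) A"
    using A by (simp add: emeasure_distr)
  also have "\<dots> = emeasure (distr M borel X \<Otimes>\<^sub>M distr M borel Z) A"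
    using ind by (simp add: indep_var_distribution_eq)
  also have "\<dots> = 0"
    using A sec by (subst emeasure_pair_measure_alt2) (auto cong: sets_pair_measure_cong)
  finally show "prob {\<omega> \<in> space M. g (X \<omega>) (Z \<omega>) = w} = 0" by (simp add: measure_def)
qed

text \<open>The integral may be restricted to C because the limit lies in C almost surely. Since C
  is Borel, passing to the completion of the law does not change the integral.\<close>

lemma (in prob_space)
  fixes V :: "nat \<Rightarrow> 'a \<Rightarrow> real"
  assumes V[measurable]: "\<And>n. random_variable borel (V n)"
    and bound: "\<And>n \<omega>. 0 \<le> V n \<omega> \<and> V n \<omega> \<le> 1"
    and lim: "AE \<omega> in M. (\<lambda>n. V n \<omega>) \<longlonglongrightarrow> l \<omega>"
    and mem: "AE \<omega> in M. l \<omega> \<in> C" and C[measurable]: "C \<in> sets borel"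
  shows bounded_limit_exists:
      "\<exists>L. random_variable borel L \<and> (AE \<omega> in M. (\<lambda>n. V n \<omega>) \<longlonglongrightarrow> L \<omega>)"
    and bounded_limit_unique:
      "\<And>L. AE \<omega> in M. (\<lambda>n. V n \<omega>) \<longlonglongrightarrow> L \<omega> \<Longrightarrow> AE \<omega> in M. L \<omega> = l \<omega>"
    and bounded_limit_expectation:
      "\<And>L. random_variable borel L \<Longrightarrow> AE \<omega> in M. (\<lambda>n. V n \<omega>) \<longlonglongrightarrow> L \<omega> \<Longrightarrow>
        (\<lambda>n. expectation (V n)) \<longlonglongrightarrow> (LINT u:C|completion (distr M borel L). u)"
proof -
  show "\<exists>L. random_variable borel L \<and> (AE \<omega> in M. (\<lambda>n. V n \<omega>) \<longlonglongrightarrow> L \<omega>)"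
  \<comment> \<open>The function \<open>l\<close> is not known to be measurable here; the pointwise
    \<open>lim\<close> is a measurable version of it.\<close>
  proof (intro exI[of _ "\<lambda>\<omega>. lim (\<lambda>n. V n \<omega>)"] conjI)
    show "random_variable borel (\<lambda>\<omega>. lim (\<lambda>n. V n \<omega>))" by measurable
    show "AE \<omega> in M. (\<lambda>n. V n \<omega>) \<longlonglongrightarrow> lim (\<lambda>n. V n \<omega>)"
      using lim by eventually_elim (metis limI)
  qed
  show uniq: "AE \<omega> in M. L \<omega> = l \<omega>" if "AE \<omega> in M. (\<lambda>n. V n \<omega>) \<longlonglongrightarrow> L \<omega>" for L
    using that lim by eventually_elim (rule LIMSEQ_unique)
  fix L assume L[measurable]: "random_variable borel L"
    and limL: "AE \<omega> in M. (\<lambda>n. V n \<omega>) \<longlonglongrightarrow> L \<omega>"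
  have "(\<lambda>n. expectation (V n)) \<longlonglongrightarrow> expectation L"
    by (rule integral_dominated_convergence[where w = "\<lambda>_. 1"]) (use limL bound in auto)
  also have "expectation L = expectation (\<lambda>\<omega>. indicator C (L \<omega>) *\<^sub>R L \<omega>)"
  proof (rule integral_cong_AE)
    show "AE \<omega> in M. L \<omega> = indicator C (L \<omega>) *\<^sub>R L \<omega>"
      using uniq[OF limL] mem by eventually_elim simp
  qed measurable
  also have "\<dots> = (\<integral>u. indicator C u *\<^sub>R u \<partial>distr M borel L)"
    by (subst integral_distr) auto
  also have "\<dots> = (LINT u:C|completion (distr M borel L). u)"
    unfolding set_lebesgue_integral_def by (subst integral_completion) auto
  finally show "(\<lambda>n. expectation (V n)) \<longlonglongrightarrow> (LINT u:C|completion (distr M borel L). u)" .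
qed

section \<open>The limiting distributions in the D-EX model\<close>

theorem theorem2p2:
  fixes M :: "'a measure" and \<alpha> \<zeta> :: real
    and n0 :: "nat \<Rightarrow> nat" and I0 :: "nat \<Rightarrow> nat set"
    and Z :: "'a \<Rightarrow> real" and X :: "nat \<Rightarrow> nat \<Rightarrow> 'a \<Rightarrow> real"
    and P :: "nat \<Rightarrow> nat \<Rightarrow> 'a \<Rightarrow> real"
    and Xs Zs Ts :: "real set"
    and g g1 g2 :: "real \<Rightarrow> real \<Rightarrow> real"
    and WX WT WZ :: "real \<Rightarrow> real"
    and F :: "real \<Rightarrow> real \<Rightarrow> real"
  assumes M: "prob_space M"
    and alpha: "0 < \<alpha>" "\<alpha> < 1"
    and intervals: "is_interval Xs" "is_interval Zs" "is_interval Ts"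
    and Z_rv: "Z \<in> borel_measurable M" "\<forall>\<omega>\<in>space M. Z \<omega> \<in> Zs"
    and WZ_cdf: "\<forall>x. WZ x = measure M {\<omega> \<in> space M. Z \<omega> \<le> x}"
    and WZ_cont: "continuous_on UNIV WZ"
    and X_rv: "\<forall>n i. X n i \<in> borel_measurable M"
    and X_range: "\<forall>n i. \<forall>\<omega>\<in>space M. i < n \<longrightarrow> X n i \<omega> \<in> Xs"
    and indep: "\<forall>n. prob_space.indep_vars M (\<lambda>_. borel)
                   (\<lambda>j. case j of None \<Rightarrow> Z | Some i \<Rightarrow> X n i) (insert None (Some ` {..<n}))"
    and g_cont: "continuous_on (Xs \<times> Zs) (\<lambda>(x, z). g x z)"
    and g_range: "\<forall>x\<in>Xs. \<forall>z\<in>Zs. g x z \<in> Ts"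
    and g_mono1: "\<forall>z\<in>Zs. strict_mono_on Xs (\<lambda>x. g x z)"
    and g_mono2: "(\<forall>x\<in>Xs. strict_mono_on Zs (g x)) \<or> (\<forall>x\<in>Xs. monotone_on Zs (<) (>) (g x))
                  \<or> (\<forall>x\<in>Xs. \<forall>z\<in>Zs. \<forall>z'\<in>Zs. g x z = g x z')"
    and g1_inv: "\<forall>x\<in>Xs. \<forall>z\<in>Zs. \<forall>w\<in>Ts. g x z = w \<longleftrightarrow> x = g1 w z"
    and g2_inv: "(\<forall>x\<in>Xs. strict_mono_on Zs (g x)) \<or> (\<forall>x\<in>Xs. monotone_on Zs (<) (>) (g x))
                  \<Longrightarrow> \<forall>x\<in>Xs. \<forall>z\<in>Zs. \<forall>w\<in>Ts. g x z = w \<longleftrightarrow> z = g2 x w"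
    and I0: "\<forall>n. I0 n \<subseteq> {..<n} \<and> card (I0 n) = n0 n"
    and zeta_lim: "(\<lambda>n. real (n0 n) / real n) \<longlonglongrightarrow> \<zeta>"
    and zeta: "0 < \<zeta>" "\<zeta> < 1"
    and WX_cdf: "\<forall>n. \<forall>i\<in>I0 n. \<forall>x. measure M {\<omega> \<in> space M. X n i \<omega> \<le> x} = WX x"
    and WX_cont: "continuous_on UNIV WX"
    and WT_cdf: "\<forall>n. \<forall>i\<in>I0 n. \<forall>t. measure M {\<omega> \<in> space M. g (X n i \<omega>) (Z \<omega>) \<le> t} = WT t"
    and P_rv: "\<forall>n i. P n i \<in> borel_measurable M"
    and P_true: "\<forall>n. \<forall>i\<in>I0 n. \<forall>\<omega>\<in>space M. P n i \<omega> = 1 - WT (g (X n i \<omega>) (Z \<omega>))"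
    and P_false: "\<forall>n i. i < n \<longrightarrow> i \<notin> I0 n \<longrightarrow> (AE \<omega> in M. P n i \<omega> = 0)"
    and F_def: "\<forall>z\<in>Zs. \<forall>t\<in>{0<..<1}. F t z = 1 - WX (g1 (gen_inv WT (1 - t)) z)"
    and F_cont: "\<forall>z\<in>Zs. continuous_on {0..1} (\<lambda>t. F t z)"
    and F_zero: "\<forall>z\<in>Zs. F 0 z = 0"
    and F_rdiff: "\<forall>z\<in>Zs. (\<lambda>t. F t z) differentiable (at_right 0)"
    and D_full: "AE \<omega> in M. Z \<omega> \<in> D_set \<alpha> \<zeta> F Zs"
    and F_decr: "\<forall>t\<in>{\<alpha> * (1 - \<zeta>)<..<\<alpha>}. monotone_on Zs (<) (>) (\<lambda>z. F t z)"
  shows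
    "let V = (\<lambda>n \<omega>. real (lsu_V \<alpha> n (I0 n) (\<lambda>i. P n i \<omega>)));
         R = (\<lambda>n \<omega>. real (lsu_R \<alpha> n (\<lambda>i. P n i \<omega>)));
         C = LCP_set \<alpha> \<zeta> F Zs;
         C1 = (\<lambda>t. t / \<alpha> - 1 + \<zeta>) ` C;
         C2 = (\<lambda>t. 1 - \<alpha> * (1 - \<zeta>) / t) ` C;
         zt = zcross \<alpha> \<zeta> WX WT g2
     in
     (\<exists>L. L \<in> borel_measurable M \<and> (AE \<omega> in M. (\<lambda>n. V n \<omega> / real n) \<longlonglongrightarrow> L \<omega>)) \<and>
     (\<forall>L. L \<in> borel_measurable M \<and> (AE \<omega> in M. (\<lambda>n. V n \<omega> / real n) \<longlonglongrightarrow> L \<omega>) \<longrightarrow>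
        (\<forall>u \<in> C1 \<inter> {0<..<\<zeta>}.
            measure M {\<omega> \<in> space M. L \<omega> \<le> u} = 1 - WZ (zt (\<alpha> * (u + 1 - \<zeta>)))) \<and>
        (\<lambda>n. integral\<^sup>L M (\<lambda>\<omega>. V n \<omega> / real n))
           \<longlonglongrightarrow> set_lebesgue_integral (completion (distr M borel L)) C1 (\<lambda>u. u)) \<and>
     (\<exists>L. L \<in> borel_measurable M \<and> (AE \<omega> in M. (\<lambda>n. V n \<omega> / max (R n \<omega>) 1) \<longlonglongrightarrow> L \<omega>)) \<and>
     (\<forall>L. L \<in> borel_measurable M \<and> (AE \<omega> in M. (\<lambda>n. V n \<omega> / max (R n \<omega>) 1) \<longlonglongrightarrow> L \<omega>) \<longrightarrow>
        (\<forall>u \<in> C2 \<inter> {0<..<\<zeta>}.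
            measure M {\<omega> \<in> space M. L \<omega> \<le> u} = 1 - WZ (zt (\<alpha> * (1 - \<zeta>) / (1 - u)))) \<and>
        (\<lambda>n. integral\<^sup>L M (\<lambda>\<omega>. V n \<omega> / max (R n \<omega>) 1))
           \<longlonglongrightarrow> set_lebesgue_integral (completion (distr M borel L)) C2 (\<lambda>u. u))"
proof -
  interpret prob_space M by (rule M)
  note [measurable] = Z_rv(1) X_rv[rule_format] P_rv[rule_format]
  have I0_sub: "I0 n \<subseteq> {..<n}" for n using I0 by blast
  have lim: "(\<lambda>n. real (card (I0 n)) / real n) \<longlonglongrightarrow> \<zeta>" using zeta_lim I0 by simp
  have "\<forall>\<^sub>F n in sequentially. 0 < real (card (I0 n)) / real n"
    using lim zeta by (intro order_tendstoD(1)) auto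
  \<comment> \<open>WX and WT are tied to the model only through true hypotheses. As \<zeta> > 0,
    some row contains one, and this single observation yields all the facts about WX and WT.\<close>
  then obtain N where "0 < real (card (I0 N)) / real N"
    using eventually_happens trivial_limit_sequentially by blast
  then have "I0 N \<noteq> {}" by auto
  then obtain j where j: "j \<in> I0 N" by blast
  then have jN: "j < N" using I0_sub by blast
  note [measurable] = X_rv[rule_format, of N j]

  have X_law: "prob {\<omega> \<in> space M. X N j \<omega> \<le> x} = WX x" for x using WX_cdf j by blast
  note WX_facts = cdf_mono[OF X_rv[rule_format] X_law] WX_cont
    cdf_at_top[OF X_rv[rule_format] X_law] cdf_at_bot[OF X_rv[rule_format] X_law]
  have X_atom: "prob {\<omega> \<in> space M. X N j \<omega> = x} = 0" for x
    using cdf_continuous_iff[OF X_rv[rule_format] X_law] WX_cont by blast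
  have Z_law: "prob {\<omega> \<in> space M. Z \<omega> \<le> x} = WZ x" for x using WZ_cdf by simp
  have Z_atom: "prob {\<omega> \<in> space M. Z \<omega> = x} = 0" for x
    using cdf_continuous_iff[OF Z_rv(1) Z_law] WZ_cont by blast
  have X_in: "\<omega> \<in> space M \<Longrightarrow> X n i \<omega> \<in> Xs" if "i \<in> I0 n" for n i \<omega>
    using X_range I0_sub that by blast
  have Z_in: "\<omega> \<in> space M \<Longrightarrow> Z \<omega> \<in> Zs" for \<omega> using Z_rv(2) by blast
  have borel: "Xs \<in> sets borel" "Zs \<in> sets borel"
    using intervals real_interval_borel_measurable by blast+
  have indep_XZ: "indep_var borel (X N j) borel Z"
  proof -
    let ?f = "case_bool (Some j) None"
    have "indep_vars (\<lambda>_. borel) (\<lambda>j. case j of None \<Rightarrow> Z | Some i \<Rightarrow> X N i) (?f ` UNIV)"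
      by (rule indep_vars_subset[OF indep[rule_format]]) (use jN in \<open>auto split: bool.splits\<close>)
    then have "indep_vars (\<lambda>_. borel) (\<lambda>b. case ?f b of None \<Rightarrow> Z | Some i \<Rightarrow> X N i) UNIV"
      by (rule indep_vars_reindex) (auto simp: inj_on_def split: bool.splits)
    then show ?thesis
      unfolding indep_var_def by (rule indep_vars_cong[THEN iffD1, rotated 3]) (auto split: bool.splits)
  qed
  have indep_X: "indep_vars (\<lambda>_. borel) (X n) (I0 n)" for n
  proof -
    have "indep_vars (\<lambda>_. borel) (\<lambda>j. case j of None \<Rightarrow> Z | Some i \<Rightarrow> X n i) (Some ` I0 n)"
      by (rule indep_vars_subset[OF indep[rule_format]]) (use I0_sub[of n] in auto)
    from indep_vars_reindex[OF this] show ?thesis by (simp add: inj_on_def)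
  qed

  let ?T = "\<lambda>\<omega>. g (X N j \<omega>) (Z \<omega>)"
  have T_rv[measurable]: "random_variable borel ?T"
    by (rule measurable_continuous_pair[OF borel g_cont]) (use X_in[OF j] Z_in in auto)
  have T_law: "prob {\<omega> \<in> space M. ?T \<omega> \<le> x} = WT x" for x using WT_cdf j by blast
  have "prob {\<omega> \<in> space M. ?T \<omega> = w} = 0" for w
    by (rule continuous_pair_no_atom[OF borel g_cont _ _ _ _ indep_XZ X_atom])
       (use X_in[OF j] Z_in g_mono1 in \<open>auto intro: strict_mono_on_imp_inj_on\<close>)
  then have WT_cont: "continuous_on UNIV WT"
    using cdf_continuous_iff[OF T_rv T_law] by blast
  note WT_facts = cdf_mono[OF T_rv T_law] WT_cont cdf_at_top[OF T_rv T_law] cdf_at_bot[OF T_rv T_law]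
  have T_in: "\<omega> \<in> space M \<Longrightarrow> ?T \<omega> \<in> Ts" for \<omega>
    using g_range X_in[OF j] Z_in by blast

  interpret pvalue_model \<alpha> \<zeta> F Zs Xs Ts g g1 g2 WX WT
  proof unfold_locales
    fix z t :: real assume "z \<in> Zs" "0 < t" "t < 1"
    then show "0 \<le> F t z \<and> F t z \<le> 1"
      using F_def cdf_bounds[OF X_rv[rule_format] X_law] by simp
  next
    fix z show "\<exists>z'\<in>Zs. z' \<noteq> z"
    proof (rule ccontr)
      assume "\<not> ?thesis"
      then have "{\<omega> \<in> space M. Z \<omega> = z} = space M" using Z_in by blast
      then show False using Z_atom[of z] prob_space by simp
    qed
  next
    fix x assume "\<And>y. y \<in> Xs \<Longrightarrow> x < y"
    then have "{\<omega> \<in> space M. X N j \<omega> \<le> x} = {}" using X_in[OF j] by force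
    then show "WX x = 0" using X_law[of x] by (metis measure_empty)
  next
    fix x assume "\<And>y. y \<in> Xs \<Longrightarrow> y < x"
    then have "{\<omega> \<in> space M. X N j \<omega> \<le> x} = space M" using X_in[OF j] by (auto intro: less_imp_le)
    then show "WX x = 1" using X_law[of x] prob_space by metis
  next
    fix w assume w: "0 < WT w" "WT w < 1"
    have "{\<omega> \<in> space M. ?T \<omega> \<le> w} \<noteq> {}" using w(1) T_law[of w] by (metis less_irrefl measure_empty)
    then obtain a where a: "a \<in> space M" "?T a \<le> w" by blast
    have "{\<omega> \<in> space M. ?T \<omega> \<le> w} \<noteq> space M" using w(2) T_law[of w] prob_space by (metis less_irrefl)
    then obtain b where b: "b \<in> space M" "\<not> ?T b \<le> w" by blast
    show "w \<in> Ts"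
      by (rule mem_is_interval_1_I[OF intervals(3) T_in[OF a(1)] T_in[OF b(1)]]) (use a b in auto)
  qed (use alpha zeta intervals F_cont F_decr g_cont g_range g_mono1 g_mono2 g2_inv g1_inv
         WX_facts WT_facts F_def F_zero in auto)

  let ?V = "\<lambda>n \<omega>. real (lsu_V \<alpha> n (I0 n) (\<lambda>i. P n i \<omega>))"
  let ?R = "\<lambda>n \<omega>. real (lsu_R \<alpha> n (\<lambda>i. P n i \<omega>))"
  let ?C = "LCP_set \<alpha> \<zeta> F Zs"
  let ?C1 = "(\<lambda>t. t / \<alpha> - 1 + \<zeta>) ` ?C"
  let ?C2 = "(\<lambda>t. 1 - \<alpha> * (1 - \<zeta>) / t) ` ?C"

  have C_pos: "0 < t" if "t \<in> ?C" for t
    using that tcross_ge_lo lo_pos by (force simp: LCP_set_def)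
  have AE_neq: "AE \<omega> in M. Z \<omega> \<noteq> c" for c
    using Z_atom[of c] by (subst AE_iff_measurable[OF _ refl]) (auto simp: emeasure_eq_measure)
  \<comment> \<open>Almost surely Z is not an end point of Zs: a least or greatest element is a
    single value and has probability 0. This provides the neighbours z1 and z2 used for fixed
    z.\<close>
  have "AE \<omega> in M. \<exists>z1\<in>Zs. z1 < Z \<omega>"
  proof (cases "\<exists>c\<in>Zs. \<forall>z\<in>Zs. c \<le> z")
    case True
    then obtain c where c: "c \<in> Zs" "\<forall>z\<in>Zs. c \<le> z" by blast
    from AE_neq[of c] AE_space show ?thesis
      by eventually_elim (use c Z_in in \<open>auto simp: order.order_iff_strict\<close>)
  next
    case False
    then have "\<exists>z1\<in>Zs. z1 < z" if "z \<in> Zs" for z using that by (auto simp: not_le)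
    then show ?thesis using Z_in by (intro AE_I2) blast
  qed
  moreover have "AE \<omega> in M. \<exists>z2\<in>Zs. Z \<omega> < z2"
  proof (cases "\<exists>c\<in>Zs. \<forall>z\<in>Zs. z \<le> c")
    case True
    then obtain c where c: "c \<in> Zs" "\<forall>z\<in>Zs. z \<le> c" by blast
    from AE_neq[of c] AE_space show ?thesis
      by eventually_elim (use c Z_in in \<open>auto simp: order.order_iff_strict\<close>)
  next
    case False
    then have "\<exists>z2\<in>Zs. z < z2" if "z \<in> Zs" for z using that by (auto simp: not_le)
    then show ?thesis using Z_in by (intro AE_I2) blast
  qed
  moreover have "AE \<omega> in M. \<forall>x. (\<lambda>n. real (card {i \<in> I0 n. x \<le> X n i \<omega>}) / real n) \<longlonglongrightarrow> \<zeta> * (1 - WX x)"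
    by (rule empirical_tail_tendsto[OF indep_X I0_sub lim _ WX_cont]) (use WX_cdf in blast)
  moreover have "AE \<omega> in M. \<forall>n. \<forall>i. i \<in> I0 n \<longrightarrow> 0 < WX (X n i \<omega>)"
    unfolding AE_all_countable
  proof (intro allI)
    fix n i
    show "AE \<omega> in M. i \<in> I0 n \<longrightarrow> 0 < WX (X n i \<omega>)"
      using AE_cdf_pos[of "X n i" WX] X_rv WX_cdf WX_cont by (cases "i \<in> I0 n") auto
  qed
  moreover have "AE \<omega> in M. \<forall>n. \<forall>i. i < n \<longrightarrow> i \<notin> I0 n \<longrightarrow> P n i \<omega> = 0"
    unfolding AE_all_countable
  proof (intro allI)
    fix n i
    show "AE \<omega> in M. i < n \<longrightarrow> i \<notin> I0 n \<longrightarrow> P n i \<omega> = 0"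
      using P_false by (cases "i < n \<and> i \<notin> I0 n") auto
  qed
  ultimately have lims: "AE \<omega> in M. (\<lambda>n. ?V n \<omega> / real n) \<longlonglongrightarrow> \<tau> (Z \<omega>) / \<alpha> - 1 + \<zeta> \<and>
      (\<lambda>n. ?V n \<omega> / max (?R n \<omega>) 1) \<longlonglongrightarrow> 1 - \<alpha> * (1 - \<zeta>) / \<tau> (Z \<omega>)"
    using D_full AE_space
  proof eventually_elim
    case (elim \<omega>)
    obtain z1 z2 where z: "z1 \<in> Zs" "z2 \<in> Zs" "z1 < Z \<omega>" "Z \<omega> < z2" using elim(1,2) by blast
    have \<omega>: "\<omega> \<in> space M" by (rule elim(7))
    have WX_pos: "0 < WX (X n i \<omega>)" if "i \<in> I0 n" for n i using elim(4) that by blast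
    have tail: "(\<lambda>n. real (card {i \<in> I0 n. x \<le> X n i \<omega>}) / real n) \<longlonglongrightarrow> \<zeta> * (1 - WX x)" for x
      using elim(3) by blast
    have P_eq: "P n i \<omega> = 1 - WT (g (X n i \<omega>) (Z \<omega>))" if "i \<in> I0 n" for n i
      using P_true \<omega> that by blast
    have P_0: "P n i \<omega> = 0" if "i < n" "i \<notin> I0 n" for n i using elim(5) that by blast
    show ?case
      using lsu_ratios_tendsto_tcross[OF Z_in[OF \<omega>] z elim(6), of I0 "\<lambda>n i. X n i \<omega>" "\<lambda>n i. P n i \<omega>",
          OF X_in[OF _ \<omega>] WX_pos tail I0_sub lim P_eq P_0]
      by (intro conjI)
  qed
  have tcross_mem: "AE \<omega> in M. \<tau> (Z \<omega>) \<in> ?C"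
    using D_full by eventually_elim (simp add: D_set_def)
  have prob_Z_ge: "prob {\<omega> \<in> space M. c \<le> Z \<omega>} = 1 - WZ c" for c
  proof -
    have "prob {\<omega> \<in> space M. c \<le> Z \<omega>} = prob {\<omega> \<in> space M. \<not> Z \<omega> \<le> c}"
      using AE_neq[of c] by (intro measure_eq_AE) (auto elim!: eventually_mono)
    also have "\<dots> = 1 - prob {\<omega> \<in> space M. Z \<omega> \<le> c}"
      by (rule prob_neg) measurable
    finally show ?thesis using Z_law by simp
  qed
  \<comment> \<open>Treats both limits at once: \<open>h\<close> is either of the two increasing
    maps from the crossing point to the limit. An LCP t is \<tau> z0 for some z0, so L \<le> u
    amounts to Z \<ge> z0, and \<open>zcross_tcross\<close> identifies z0.\<close>
  have law: "prob {\<omega> \<in> space M. L \<omega> \<le> u} = 1 - WZ (zcross \<alpha> \<zeta> WX WT g2 t)"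
    if t: "t \<in> ?C" "lo < t" "t < \<alpha>" and L: "random_variable borel L"
      and eq: "AE \<omega> in M. L \<omega> = h (\<tau> (Z \<omega>))" and h: "\<And>s. 0 < s \<Longrightarrow> h s \<le> u \<longleftrightarrow> s \<le> t"
    for L :: "'a \<Rightarrow> real" and h :: "real \<Rightarrow> real" and t u :: real
  proof -
    note [measurable] = L
    have sets: "{\<omega> \<in> space M. L \<omega> \<le> u} \<in> events" by measurable
    obtain z0 where z0: "z0 \<in> Zs" "t = \<tau> z0" using t(1) by (auto simp: LCP_set_def)
    have "AE \<omega> in M. L \<omega> \<le> u \<longleftrightarrow> z0 \<le> Z \<omega>"
      using eq AE_space
    proof eventually_elim
      case (elim \<omega>)
      have "0 < \<tau> (Z \<omega>)" using tcross_ge_lo[OF Z_in] elim lo_pos by force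
      then show ?case using h elim tcross_le_iff[OF Z_in z0(1)] t z0 by simp
    qed
    then have "prob {\<omega> \<in> space M. L \<omega> \<le> u} = prob {\<omega> \<in> space M. z0 \<le> Z \<omega>}"
      using sets by (intro measure_eq_AE) (auto elim!: eventually_mono)
    then show ?thesis using prob_Z_ge zcross_tcross z0 t by simp
  qed

  have V_meas[measurable]: "random_variable borel (?V n)" for n
    by (rule lsu_V_measurable[OF _ I0_sub]) measurable
  have R_meas[measurable]: "random_variable borel (?R n)" for n
    by (rule lsu_R_measurable) (use alpha in auto)
  have V_le_R: "?V n \<omega> \<le> ?R n \<omega>" and R_le: "?R n \<omega> \<le> real n" for n \<omega>
    using lsu_V_le_R lsu_R_le by (simp_all add: of_nat_le_iff)

  have C1_borel: "?C1 \<in> sets borel"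
  proof -
    have "?C1 = {u. \<alpha> * (u + 1 - \<zeta>) \<in> ?C}"
      using alpha by (force simp: image_iff field_simps)
    also have "\<dots> \<in> sets borel" using LCP_set_borel by measurable
    finally show ?thesis .
  qed
  have C2_inv: "\<alpha> * (1 - \<zeta>) / (1 - (1 - \<alpha> * (1 - \<zeta>) / t)) = t" if "0 < t" for t
    using that alpha zeta by simp
  have C2_borel: "?C2 \<in> sets borel"
  proof -
    have "?C2 = {u. u < 1 \<and> \<alpha> * (1 - \<zeta>) / (1 - u) \<in> ?C}"
    proof (intro set_eqI iffI)
      fix u assume "u \<in> ?C2"
      then obtain t where "t \<in> ?C" "u = 1 - \<alpha> * (1 - \<zeta>) / t" by blast
      then show "u \<in> {u. u < 1 \<and> \<alpha> * (1 - \<zeta>) / (1 - u) \<in> ?C}"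
        using C_pos[of t] C2_inv[of t] alpha zeta by simp
    next
      fix u assume "u \<in> {u. u < 1 \<and> \<alpha> * (1 - \<zeta>) / (1 - u) \<in> ?C}"
      moreover then have "u = 1 - \<alpha> * (1 - \<zeta>) / (\<alpha> * (1 - \<zeta>) / (1 - u))"
        using alpha zeta by simp
      ultimately show "u \<in> ?C2" by blast
    qed
    also have "\<dots> \<in> sets borel" using LCP_set_borel by measurable
    finally show ?thesis .
  qed

  have lim1: "AE \<omega> in M. (\<lambda>n. ?V n \<omega> / real n) \<longlonglongrightarrow> \<tau> (Z \<omega>) / \<alpha> - 1 + \<zeta>"
    using lims by eventually_elim simp
  have mem1: "AE \<omega> in M. \<tau> (Z \<omega>) / \<alpha> - 1 + \<zeta> \<in> ?C1"
    using tcross_mem by eventually_elim (rule imageI)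
  have bound1: "0 \<le> ?V n \<omega> / real n \<and> ?V n \<omega> / real n \<le> 1" for n \<omega>
    using order_trans[OF V_le_R R_le, of n \<omega>]
    by (cases "n = 0") (simp_all add: divide_le_eq_1)
  have lim2: "AE \<omega> in M. (\<lambda>n. ?V n \<omega> / max (?R n \<omega>) 1) \<longlonglongrightarrow> 1 - \<alpha> * (1 - \<zeta>) / \<tau> (Z \<omega>)"
    using lims by eventually_elim simp
  have mem2: "AE \<omega> in M. 1 - \<alpha> * (1 - \<zeta>) / \<tau> (Z \<omega>) \<in> ?C2"
    using tcross_mem by eventually_elim (rule imageI)
  have bound2: "0 \<le> ?V n \<omega> / max (?R n \<omega>) 1 \<and> ?V n \<omega> / max (?R n \<omega>) 1 \<le> 1" for n \<omega>
    using V_le_R[of n \<omega>] by (simp add: divide_le_eq_1 max_def)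
  have meas1: "random_variable borel (\<lambda>\<omega>. ?V n \<omega> / real n)" for n by measurable
  have meas2: "random_variable borel (\<lambda>\<omega>. ?V n \<omega> / max (?R n \<omega>) 1)" for n by measurable
  note limit1 = meas1 bound1 lim1 mem1 C1_borel
  note limit2 = meas2 bound2 lim2 mem2 C2_borel

  have law1: "prob {\<omega> \<in> space M. L \<omega> \<le> u} = 1 - WZ (zcross \<alpha> \<zeta> WX WT g2 (\<alpha> * (u + 1 - \<zeta>)))"
    if L: "random_variable borel L" "AE \<omega> in M. (\<lambda>n. ?V n \<omega> / real n) \<longlonglongrightarrow> L \<omega>"
      and u: "u \<in> ?C1 \<inter> {0<..<\<zeta>}" for L u
  proof (rule law[OF _ _ _ L(1) bounded_limit_unique[OF limit1 L(2)]])
    show "\<alpha> * (u + 1 - \<zeta>) \<in> ?C" using u alpha by (auto simp: field_simps)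
    \<comment> \<open>The condition 0 < u < \<zeta> says exactly that the crossing point is
      interior, where \<tau> is injective; the same correspondence holds for the second
      limit.\<close>
    show "lo < \<alpha> * (u + 1 - \<zeta>)" "\<alpha> * (u + 1 - \<zeta>) < \<alpha>"
      using u alpha by (auto simp: lo_def)
    show "s / \<alpha> - 1 + \<zeta> \<le> u \<longleftrightarrow> s \<le> \<alpha> * (u + 1 - \<zeta>)" for s
      using alpha by (simp add: field_simps)
  qed
  have law2: "prob {\<omega> \<in> space M. L \<omega> \<le> u} = 1 - WZ (zcross \<alpha> \<zeta> WX WT g2 (\<alpha> * (1 - \<zeta>) / (1 - u)))"
    if L: "random_variable borel L" "AE \<omega> in M. (\<lambda>n. ?V n \<omega> / max (?R n \<omega>) 1) \<longlonglongrightarrow> L \<omega>"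
      and u: "u \<in> ?C2 \<inter> {0<..<\<zeta>}" for L u
  proof (rule law[OF _ _ _ L(1) bounded_limit_unique[OF limit2 L(2)]])
    show "\<alpha> * (1 - \<zeta>) / (1 - u) \<in> ?C" using u C_pos C2_inv by auto
    show "lo < \<alpha> * (1 - \<zeta>) / (1 - u)" "\<alpha> * (1 - \<zeta>) / (1 - u) < \<alpha>"
      using u alpha zeta lo_pos by (auto simp: lo_def field_simps)
    show "1 - \<alpha> * (1 - \<zeta>) / s \<le> u \<longleftrightarrow> s \<le> \<alpha> * (1 - \<zeta>) / (1 - u)" if "0 < s" for s
      using that u zeta by (auto simp: field_simps)
  qed
  show ?thesis
    unfolding Let_def
  proof (intro conjI allI impI ballI)
    show "\<exists>L. random_variable borel L \<and> (AE \<omega> in M. (\<lambda>n. ?V n \<omega> / real n) \<longlonglongrightarrow> L \<omega>)"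
      by (rule bounded_limit_exists[OF limit1])
    show "\<exists>L. random_variable borel L \<and> (AE \<omega> in M. (\<lambda>n. ?V n \<omega> / max (?R n \<omega>) 1) \<longlonglongrightarrow> L \<omega>)"
      by (rule bounded_limit_exists[OF limit2])
  qed (elim conjE, (rule law1 law2 bounded_limit_expectation[OF limit1] bounded_limit_expectation[OF limit2]; assumption))+
qed

end
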